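(* If $\Gamma$ is an outerplanar graph that contains at least one odd cycle, then for any group $G$ of automorphisms of $\Gamma$, every real root of $OP_{\Gamma,G}(x)$ is at most the largest real root of $P_{\Gamma}(x)$.
   Context: Graphs are finite. $P_{\Gamma}(x)$ is the chromatic polynomial of $\Gamma$ (number of proper $x$-colorings at positive integers $x$; identically $0$ if $\Gamma$ has a loop). For an automorphism $g$, $\Gamma/g$ is the graph whose vertices are the orbits of $\langle g\rangle$ on $V(\Gamma)$, two orbits $O_1,O_2$ being adjacent (a loop if $O_1=O_2$) whenever some vertex of $O_1$ is adjacent in $\Gamma$ to some vertex of $O_2$. For a group $G$ of automorphisms, $OP_{\Gamma,G}(x)=\frac{1}{|G|}\sum_{g\in G}P_{\Gamma/g}(x)$ is the orbital chromatic polynomial, whose value at a positive integer $k$ is the number of $G$-orbits of proper $k$-colorings of $\Gamma$. *)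

theory Defs
  imports
    "HOL-Analysis.Analysis"
    "HOL-Algebra.Group_Action"
    "HOL-Algebra.Elementary_Groups"
    "HOL-Computational_Algebra.Polynomial"
    "Graph_Theory.Pair_Digraph"
begin

text \<open>An undirected graph without parallel edges is a symmetric pair digraph: \<open>pair_graph\<close> is
  a finite simple graph, \<open>pair_pseudo_graph\<close> additionally admits loops.\<close>

definition proper_colorings :: "'a pair_pre_digraph \<Rightarrow> nat \<Rightarrow> ('a \<Rightarrow> nat) set" where
  "proper_colorings \<Gamma> k =
     {c \<in> pverts \<Gamma> \<rightarrow>\<^sub>E {..<k}. \<forall>(u, v) \<in> parcs \<Gamma>. c u \<noteq> c v}"

definition chromatic_poly :: "'a pair_pre_digraph \<Rightarrow> real poly" where
  "chromatic_poly \<Gamma> =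
     (THE p. \<forall>k>0. poly p (of_nat k) = of_nat (card (proper_colorings \<Gamma> k)))"

definition graph_aut_group :: "'a pair_pre_digraph \<Rightarrow> ('a \<Rightarrow> 'a) monoid" where
  "graph_aut_group \<Gamma> = BijGroup (pverts \<Gamma>)
     \<lparr>carrier := {f \<in> Bij (pverts \<Gamma>).
        \<forall>u \<in> pverts \<Gamma>. \<forall>v \<in> pverts \<Gamma>. (f u, f v) \<in> parcs \<Gamma> \<longleftrightarrow> (u, v) \<in> parcs \<Gamma>}\<rparr>"

lemma group_graph_aut_group: "group (graph_aut_group \<Gamma>)"
proof -
  let ?V = "pverts \<Gamma>"
  let ?H = "{f \<in> Bij ?V. \<forall>u \<in> ?V. \<forall>v \<in> ?V. (f u, f v) \<in> parcs \<Gamma> \<longleftrightarrow> (u, v) \<in> parcs \<Gamma>}"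
  interpret B: group "BijGroup ?V" by (rule group_BijGroup)
  have mem: "f u \<in> ?V" if "f \<in> Bij ?V" "u \<in> ?V" for f u
    using Bij_imp_funcset[OF that(1)] that(2) by blast
  have "subgroup ?H (BijGroup ?V)"
  proof (rule B.subgroupI)
    show "?H \<subseteq> carrier (BijGroup ?V)" by (auto simp: BijGroup_def)
    have "(\<lambda>x\<in>?V. x) \<in> ?H" using id_Bij by simp
    then show "?H \<noteq> {}" by blast
  next
    fix f assume f: "f \<in> ?H"
    then have fB: "f \<in> Bij ?V" by blast
    have inv: "inv\<^bsub>BijGroup ?V\<^esub> f = (\<lambda>x\<in>?V. (inv_into ?V f) x)" by (rule inv_BijGroup[OF fB])
    have 1: "inv_into ?V f u \<in> ?V" "f (inv_into ?V f u) = u" if "u \<in> ?V" for u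
      using that fB Bij_inv_into_mem[OF fB] by (auto simp: Bij_def bij_betw_inv_into_right)
    have "(inv_into ?V f u, inv_into ?V f v) \<in> parcs \<Gamma> \<longleftrightarrow> (u, v) \<in> parcs \<Gamma>"
      if u: "u \<in> ?V" and v: "v \<in> ?V" for u v
    proof -
      have "(f (inv_into ?V f u), f (inv_into ?V f v)) \<in> parcs \<Gamma> \<longleftrightarrow>
          (inv_into ?V f u, inv_into ?V f v) \<in> parcs \<Gamma>"
        using f 1(1)[OF u] 1(1)[OF v] by blast
      then show ?thesis by (simp only: 1(2)[OF u] 1(2)[OF v])
    qed
    then show "inv\<^bsub>BijGroup ?V\<^esub> f \<in> ?H"
      unfolding inv using restrict_inv_into_Bij[OF fB] by simp
  next
    fix f g assume f: "f \<in> ?H" and g: "g \<in> ?H"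
    then have B: "f \<in> Bij ?V" "g \<in> Bij ?V" by blast+
    then have "f \<otimes>\<^bsub>BijGroup ?V\<^esub> g = compose ?V f g" by (simp add: BijGroup_def)
    moreover have "compose ?V f g \<in> ?H"
      using f g compose_Bij[OF B] mem[OF B(2)] by (simp add: compose_eq)
    ultimately show "f \<otimes>\<^bsub>BijGroup ?V\<^esub> g \<in> ?H" by simp
  qed
  then show ?thesis
    unfolding graph_aut_group_def by (rule B.subgroup_imp_group)
qed

definition cyclic_orbits :: "'a pair_pre_digraph \<Rightarrow> ('a \<Rightarrow> 'a) \<Rightarrow> 'a set set" where
  "cyclic_orbits \<Gamma> g =
     orbits (subgroup_generated (graph_aut_group \<Gamma>) {g}) (pverts \<Gamma>) (\<lambda>h. h)"

definition quotient_graph :: "'a pair_pre_digraph \<Rightarrow> ('a \<Rightarrow> 'a) \<Rightarrow> 'a set pair_pre_digraph" where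
  "quotient_graph \<Gamma> g =
     \<lparr>pverts = cyclic_orbits \<Gamma> g,
      parcs = {(O1, O2). O1 \<in> cyclic_orbits \<Gamma> g \<and> O2 \<in> cyclic_orbits \<Gamma> g \<and>
        (\<exists>u \<in> O1. \<exists>v \<in> O2. (u, v) \<in> parcs \<Gamma>)}\<rparr>"

definition orbital_chromatic_poly :: "'a pair_pre_digraph \<Rightarrow> ('a \<Rightarrow> 'a) set \<Rightarrow> real poly" where
  "orbital_chromatic_poly \<Gamma> G =
     smult (1 / of_nat (card G)) (\<Sum>g\<in>G. chromatic_poly (quotient_graph \<Gamma> g))"

text \<open>The edge \<open>{u, v}\<close> is drawn as the arc \<open>\<gamma> {u, v}\<close> (traversed in either direction) joining
  the points \<open>p u\<close> and \<open>p v\<close>. The last two conditions say that an edge passes through no vertex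
  other than its ends and that two edges meet only in common ends.\<close>

definition plane_drawing ::
    "'a pair_pre_digraph \<Rightarrow> ('a \<Rightarrow> complex) \<Rightarrow> ('a set \<Rightarrow> real \<Rightarrow> complex) \<Rightarrow> bool" where
  "plane_drawing \<Gamma> p \<gamma> \<longleftrightarrow>
     inj_on p (pverts \<Gamma>) \<and>
     (\<forall>(u, v) \<in> parcs \<Gamma>. arc (\<gamma> {u, v}) \<and>
        {pathstart (\<gamma> {u, v}), pathfinish (\<gamma> {u, v})} = {p u, p v}) \<and>
     (\<forall>(u, v) \<in> parcs \<Gamma>. path_image (\<gamma> {u, v}) \<inter> p ` pverts \<Gamma> = {p u, p v}) \<and>
     (\<forall>(u, v) \<in> parcs \<Gamma>. \<forall>(x, y) \<in> parcs \<Gamma>. {u, v} \<noteq> {x, y} \<longrightarrow>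
        path_image (\<gamma> {u, v}) \<inter> path_image (\<gamma> {x, y}) \<subseteq> p ` ({u, v} \<inter> {x, y}))"

definition drawing_image ::
    "'a pair_pre_digraph \<Rightarrow> ('a \<Rightarrow> complex) \<Rightarrow> ('a set \<Rightarrow> real \<Rightarrow> complex) \<Rightarrow> complex set" where
  "drawing_image \<Gamma> p \<gamma> = p ` pverts \<Gamma> \<union> (\<Union>(u, v) \<in> parcs \<Gamma>. path_image (\<gamma> {u, v}))"

text \<open>The outer face of a drawing is the unbounded component of its complement, \<open>outside\<close>.\<close>

definition outerplanar :: "'a pair_pre_digraph \<Rightarrow> bool" where
  "outerplanar \<Gamma> \<longleftrightarrow>
     (\<exists>p \<gamma>. plane_drawing \<Gamma> p \<gamma> \<and>
        p ` pverts \<Gamma> \<subseteq> frontier (outside (drawing_image \<Gamma> p \<gamma>)))"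

text \<open>A loopfree symmetric digraph has cycles of length 2 (an edge traversed back and forth);
  those of odd length are the odd cycles of the undirected graph.\<close>

definition has_odd_cycle :: "'a pair_pre_digraph \<Rightarrow> bool" where
  "has_odd_cycle \<Gamma> \<longleftrightarrow> (\<exists>c. pre_digraph.cycle (with_proj \<Gamma>) c \<and> odd (length c))"

definition is_largest_real_root :: "real poly \<Rightarrow> real \<Rightarrow> bool" where
  "is_largest_real_root q r \<longleftrightarrow> poly q r = 0 \<and> (\<forall>y. poly q y = 0 \<longrightarrow> y \<le> r)"

text \<open>\<open>chromatic_poly\<close> is well defined: grouping colorings by the set of colors used,
  the number of proper \<open>k\<close>-colorings is \<open>\<Sum>j\<le>card V. (k choose j) * a j\<close>, where \<open>a j\<close> is the
  number of proper colorings using exactly the colors below \<open>j\<close>.\<close>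

lemma card_proper_colorings_onto:
  assumes G: "pair_fin_digraph \<Gamma>" and S: "finite S"
  shows "card {c \<in> pverts \<Gamma> \<rightarrow>\<^sub>E (S :: nat set). c ` pverts \<Gamma> = S \<and> (\<forall>(u, v) \<in> parcs \<Gamma>. c u \<noteq> c v)} =
         card {c \<in> pverts \<Gamma> \<rightarrow>\<^sub>E {..<card S}. c ` pverts \<Gamma> = {..<card S} \<and> (\<forall>(u, v) \<in> parcs \<Gamma>. c u \<noteq> c v)}"
    (is "card ?A = card ?B")
proof -
  interpret pair_fin_digraph \<Gamma> by (rule G)
  let ?V = "pverts \<Gamma>"
  obtain h where h: "bij_betw h S {..<card S}"
    using S by (metis bij_betw_iff_card card_lessThan finite_lessThan)
  define h' where "h' = inv_into S h"
  have h': "bij_betw h' {..<card S} S"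
    unfolding h'_def by (rule bij_betw_inv_into[OF h])
  have hh': "h (h' y) = y" if "y < card S" for y
    using that h unfolding h'_def by (simp add: bij_betw_inv_into_right)
  have h'h: "h' (h x) = x" if "x \<in> S" for x
    using that h unfolding h'_def by (simp add: bij_betw_inv_into_left)
  have hS: "h ` S = {..<card S}" and h'S: "h' ` {..<card S} = S"
    using h h' by (auto simp: bij_betw_def)
  have inj: "h x = h y \<longleftrightarrow> x = y" if "x \<in> S" "y \<in> S" for x y
    using that h'h by metis
  have inj': "h' x = h' y \<longleftrightarrow> x = y" if "x < card S" "y < card S" for x y
    using that hh' by metis
  have "bij_betw (\<lambda>c. restrict (h \<circ> c) ?V) ?A ?B"
  proof (rule bij_betw_byWitness[where f' = "\<lambda>c. restrict (h' \<circ> c) ?V"])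
    show "\<forall>c\<in>?A. restrict (h' \<circ> restrict (h \<circ> c) ?V) ?V = c"
    proof
      fix c assume "c \<in> ?A"
      then have c: "c \<in> ?V \<rightarrow>\<^sub>E S" by blast
      show "restrict (h' \<circ> restrict (h \<circ> c) ?V) ?V = c"
      proof
        fix x show "restrict (h' \<circ> restrict (h \<circ> c) ?V) ?V x = c x"
          using h'h PiE_mem[OF c, of x] PiE_arb[OF c, of x] by (cases "x \<in> ?V") simp_all
      qed
    qed
    show "\<forall>c\<in>?B. restrict (h \<circ> restrict (h' \<circ> c) ?V) ?V = c"
    proof
      fix c assume "c \<in> ?B"
      then have c: "c \<in> ?V \<rightarrow>\<^sub>E {..<card S}" by blast
      show "restrict (h \<circ> restrict (h' \<circ> c) ?V) ?V = c"
      proof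
        fix x show "restrict (h \<circ> restrict (h' \<circ> c) ?V) ?V x = c x"
          using hh' PiE_mem[OF c, of x] PiE_arb[OF c, of x] by (cases "x \<in> ?V") simp_all
      qed
    qed
    show "(\<lambda>c. restrict (h \<circ> c) ?V) ` ?A \<subseteq> ?B"
    proof (rule image_subsetI)
      fix c assume "c \<in> ?A"
      then have c: "c \<in> ?V \<rightarrow>\<^sub>E S" and im: "c ` ?V = S"
        and pr: "\<And>u v. (u, v) \<in> parcs \<Gamma> \<Longrightarrow> c u \<noteq> c v" by blast+
      have 1: "restrict (h \<circ> c) ?V ` ?V = {..<card S}"
        by (simp only: image_restrict_eq image_comp[symmetric] im hS)
      have 2: "restrict (h \<circ> c) ?V u \<noteq> restrict (h \<circ> c) ?V v" if "(u, v) \<in> parcs \<Gamma>" for u v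
        using pr[OF that] inj[OF PiE_mem[OF c] PiE_mem[OF c]] wellformed'[OF that] by simp
      have 3: "restrict (h \<circ> c) ?V \<in> ?V \<rightarrow>\<^sub>E {..<card S}"
        by (rule PiE_I) (use 1 in blast, simp)
      show "restrict (h \<circ> c) ?V \<in> ?B"
        using 1 2 3 by blast
    qed
    show "(\<lambda>c. restrict (h' \<circ> c) ?V) ` ?B \<subseteq> ?A"
    proof (rule image_subsetI)
      fix c assume "c \<in> ?B"
      then have c: "c \<in> ?V \<rightarrow>\<^sub>E {..<card S}" and im: "c ` ?V = {..<card S}"
        and pr: "\<And>u v. (u, v) \<in> parcs \<Gamma> \<Longrightarrow> c u \<noteq> c v" by blast+
      have 1: "restrict (h' \<circ> c) ?V ` ?V = S"
        by (simp only: image_restrict_eq image_comp[symmetric] im h'S)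
      have 2: "restrict (h' \<circ> c) ?V u \<noteq> restrict (h' \<circ> c) ?V v" if "(u, v) \<in> parcs \<Gamma>" for u v
        using pr[OF that] inj'[OF PiE_mem[OF c, unfolded lessThan_iff] PiE_mem[OF c, unfolded lessThan_iff]] wellformed'[OF that] by simp
      have 3: "restrict (h' \<circ> c) ?V \<in> ?V \<rightarrow>\<^sub>E S"
        by (rule PiE_I) (use 1 in blast, simp)
      show "restrict (h' \<circ> c) ?V \<in> ?A"
        using 1 2 3 by blast
    qed
  qed
  then show ?thesis by (rule bij_betw_same_card)
qed

lemma card_proper_colorings_eq:
  assumes G: "pair_fin_digraph \<Gamma>"
  shows "card (proper_colorings \<Gamma> k) = (\<Sum>j\<le>card (pverts \<Gamma>). (k choose j) *
    card {c \<in> pverts \<Gamma> \<rightarrow>\<^sub>E {..<j}. c ` pverts \<Gamma> = {..<j} \<and> (\<forall>(u, v) \<in> parcs \<Gamma>. c u \<noteq> c v)})"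
proof -
  interpret pair_fin_digraph \<Gamma> by (rule G)
  let ?V = "pverts \<Gamma>"
  define A where "A S = {c \<in> ?V \<rightarrow>\<^sub>E (S :: nat set). c ` ?V = S \<and> (\<forall>(u, v) \<in> parcs \<Gamma>. c u \<noteq> c v)}" for S
  define T where "T j = {S. S \<subseteq> {..<k} \<and> card S = j}" for j
  have finV: "finite ?V" by (rule pair_finite_verts)
  have finA: "finite (A S)" if "finite S" for S
    unfolding A_def using finite_PiE[OF finV, of "\<lambda>_. S"] that by auto
  have finT: "finite (T j)" for j unfolding T_def by (rule finite_subset[of _ "Pow {..<k}"]) auto
  have A_card: "card (A S) = card (A {..<card S})" if "finite S" for S
    using card_proper_colorings_onto[OF G that] unfolding A_def by simp
  have eq: "proper_colorings \<Gamma> k = (\<Union>S \<in> (\<Union>j\<le>card ?V. T j). A S)"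
  proof (intro equalityI subsetI)
    fix c assume c: "c \<in> proper_colorings \<Gamma> k"
    have "c ` ?V \<in> T (card (c ` ?V))" using c by (auto simp: T_def proper_colorings_def)
    moreover have "card (c ` ?V) \<le> card ?V" by (rule card_image_le[OF finV])
    moreover have "c \<in> A (c ` ?V)" using c by (auto simp: A_def proper_colorings_def PiE_iff)
    ultimately show "c \<in> (\<Union>S \<in> (\<Union>j\<le>card ?V. T j). A S)" by blast
  next
    fix c assume "c \<in> (\<Union>S \<in> (\<Union>j\<le>card ?V. T j). A S)"
    then obtain S where "S \<subseteq> {..<k}" and c: "c \<in> A S" by (auto simp: T_def)
    then have "c \<in> ?V \<rightarrow>\<^sub>E {..<k}" using PiE_mono[of ?V "\<lambda>_. S" "\<lambda>_. {..<k}"] by (auto simp: A_def)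
    with c show "c \<in> proper_colorings \<Gamma> k"
      by (simp add: A_def proper_colorings_def)
  qed
  have "card (proper_colorings \<Gamma> k) = (\<Sum>S \<in> (\<Union>j\<le>card ?V. T j). card (A S))"
    unfolding eq
  proof (rule card_UN_disjoint)
    show "\<forall>S\<in>(\<Union>j\<le>card ?V. T j). finite (A S)"
      by (auto simp: T_def intro!: finA intro: finite_subset[OF _ finite_lessThan])
    show "\<forall>S\<in>(\<Union>j\<le>card ?V. T j). \<forall>S'\<in>(\<Union>j\<le>card ?V. T j). S \<noteq> S' \<longrightarrow> A S \<inter> A S' = {}"
      by (auto simp: A_def)
  qed (use finT in auto)
  also have "\<dots> = (\<Sum>j\<le>card ?V. \<Sum>S \<in> T j. card (A S))"
    by (rule sum.UNION_disjoint) (use finT in \<open>auto simp: T_def\<close>)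
  also have "\<dots> = (\<Sum>j\<le>card ?V. \<Sum>S \<in> T j. card (A {..<j}))"
  proof (rule sum.cong[OF refl], rule sum.cong[OF refl])
    fix j S assume "S \<in> T j"
    then have "finite S" "card S = j" by (auto simp: T_def intro: finite_subset[OF _ finite_lessThan])
    then show "card (A S) = card (A {..<j})" using A_card by blast
  qed
  also have "\<dots> = (\<Sum>j\<le>card ?V. (k choose j) * card (A {..<j}))"
    by (simp add: T_def n_subsets)
  finally show ?thesis unfolding A_def .
qed

lemma ex1_chromatic_poly:
  assumes G: "pair_fin_digraph \<Gamma>"
  shows "\<exists>!p :: real poly. \<forall>k>0. poly p (of_nat k) = of_nat (card (proper_colorings \<Gamma> k))"
proof (rule ex_ex1I)
  define a where "a j = card {c \<in> pverts \<Gamma> \<rightarrow>\<^sub>E {..<j}. c ` pverts \<Gamma> = {..<j} \<and>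
    (\<forall>(u, v) \<in> parcs \<Gamma>. c u \<noteq> c v)}" for j :: nat
  define p :: "real poly" where "p = (\<Sum>j\<le>card (pverts \<Gamma>).
    smult (of_nat (a j) / fact j) (\<Prod>i<j. [:- of_nat i, 1:]))"
  have "poly p (of_nat k) = of_nat (card (proper_colorings \<Gamma> k))" for k
  proof -
    have "poly p (of_nat k) = (\<Sum>j\<le>card (pverts \<Gamma>). of_nat (k choose j) * of_nat (a j))"
      unfolding p_def poly_sum
      by (intro sum.cong refl)
         (simp add: poly_prod binomial_gbinomial gbinomial_prod_rev atLeast0LessThan)
    then show ?thesis
      unfolding card_proper_colorings_eq[OF G] a_def by simp
  qed
  then show "\<exists>p :: real poly. \<forall>k>0. poly p (of_nat k) = of_nat (card (proper_colorings \<Gamma> k))"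
    by blast
next
  fix p q :: "real poly"
  assume p: "\<forall>k>0. poly p (of_nat k) = of_nat (card (proper_colorings \<Gamma> k))"
    and q: "\<forall>k>0. poly q (of_nat k) = of_nat (card (proper_colorings \<Gamma> k))"
  have "real ` {0<..} \<subseteq> {x. poly (p - q) x = 0}" using p q by auto
  moreover have "infinite (real ` {0<..})"
    by (simp add: finite_image_iff infinite_Ioi inj_on_def)
  ultimately have "infinite {x. poly (p - q) x = 0}" using finite_subset by blast
  then show "p = q" using poly_roots_finite[of "p - q"] by fastforce
qed

lemma poly_chromatic_poly:
  assumes "pair_fin_digraph \<Gamma>" and "k > 0"
  shows "poly (chromatic_poly \<Gamma>) (of_nat k) = of_nat (card (proper_colorings \<Gamma> k))"
  using theI'[OF ex1_chromatic_poly[OF assms(1)]] assms(2) unfolding chromatic_poly_def by blast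

end

theory Submission
  imports Defs
begin

text \<open>An odd cycle makes 2 a root of the chromatic polynomial, and 2 turns out to be the largest root
  that can occur. Proper colorings of \<open>\<Gamma>/g\<close> are the \<open>g\<close>-invariant proper colorings of \<open>\<Gamma>\<close>. They are
  counted by induction over the \<open>g\<close>-invariant induced minors of \<open>\<Gamma>\<close>: in a minor choose a vertex \<open>v\<close> of
  degree at most 2. If its \<open>g\<close>-orbit is not independent there are no colorings. Otherwise, with \<open>M'\<close>
  the minor after deletion of the orbit and \<open>M''\<close> the minor after contraction of all edges at the orbit,
  the count is \<open>x M'\<close>, \<open>(x - 1) M'\<close> or \<open>(x - 2) M' + M''\<close> (where \<open>M''\<close> counts as zero if it has a loop).
  So the chromatic polynomial of \<open>\<Gamma>/g\<close> is nonnegative on \<open>x \<ge> 2\<close>, and positive on \<open>x > 2\<close> for \<open>g = 1\<close>.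

  A vertex of degree at most 2 exists because a graph of minimum degree 3 has a \<open>K\<^sub>4\<close> minor, hence
  contains a subdivision of \<open>K\<^sub>4\<close>, and a plane \<open>K\<^sub>4\<close> cannot have all four vertices on the outer face:
  each of two opposite edges would be a chord inside the 4-cycle formed by the other edges.\<close>

section \<open>Arcs in the plane\<close>

text \<open>Outerplanarity is traded at once for the absence of a K4 minor, a property that minors
  inherit without any redrawing. The graph \<Gamma>/g is never analysed as such: all degree bounds
  come from minors of \<Gamma>, and invariance lets one vertex speak for its orbit. Since g carries
  neighbors to neighbors, every member of an independent orbit sees the same set of at most two
  colors. The common color of the orbit can then be chosen in k - 2, k - 1 or k ways, and the extra
  choice that arises when two neighbors agree is the contraction term. The number 2 is thus the
  largest root of the factors x, x - 1 and x - 2, and the odd cycle makes it a root for \<Gamma>.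
  Strict positivity is followed for g = 1 only. There every orbit is a single vertex, so the case
  without colorings does not occur, and in (x - 2) M' + M'' the first term alone has to be positive.
  This suffices, because the identity contributes one term to the average over G.\<close>

definition arc_between :: "complex set \<Rightarrow> complex \<Rightarrow> complex \<Rightarrow> bool" where
  "arc_between S a b \<longleftrightarrow> (\<exists>\<gamma>. arc \<gamma> \<and> pathstart \<gamma> = a \<and> pathfinish \<gamma> = b \<and> path_image \<gamma> = S)"

text \<open>A drawn edge \<open>\<gamma> {u, v}\<close> may run in either direction. This is also
  why arcs are kept as point sets with named ends.\<close>

lemma arc_between_sym: "arc_between S a b \<Longrightarrow> arc_between S b a"
  unfolding arc_between_def
  by (metis arc_reversepath path_image_reversepath pathfinish_reversepath pathstart_reversepath)

lemma arc_between_ends: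
  assumes "arc_between S a b"
  shows "a \<in> S" "b \<in> S" "a \<noteq> b"
  using assms unfolding arc_between_def by (auto dest: arc_distinct_ends)

lemma arc_between_compact: "arc_between S a b \<Longrightarrow> compact S"
  and arc_between_connected: "arc_between S a b \<Longrightarrow> connected S"
  unfolding arc_between_def by (auto intro: compact_arc_image connected_arc_image)

lemma arc_between_join:
  assumes "arc_between S a b" "arc_between T b c" "S \<inter> T = {b}"
  shows "arc_between (S \<union> T) a c"
proof -
  obtain \<gamma> \<delta> where "arc \<gamma>" "pathstart \<gamma> = a" "pathfinish \<gamma> = b" "path_image \<gamma> = S"
    "arc \<delta>" "pathstart \<delta> = b" "pathfinish \<delta> = c" "path_image \<delta> = T"
    using assms unfolding arc_between_def by blast
  with assms(3) have "arc (\<gamma> +++ \<delta>)" "pathstart (\<gamma> +++ \<delta>) = a" "pathfinish (\<gamma> +++ \<delta>) = c"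
    "path_image (\<gamma> +++ \<delta>) = S \<union> T"
    by (auto intro!: arc_join simp: path_image_join)
  then show ?thesis unfolding arc_between_def by blast
qed

text \<open>Keeps an arc on one side of a closed curve that it touches in one end only.\<close>

lemma arc_between_connected_minus_end:
  assumes "arc_between S a b"
  shows "connected (S - {a})"
proof -
  obtain \<gamma> where \<gamma>: "arc \<gamma>" "pathstart \<gamma> = a" "path_image \<gamma> = S"
    using assms unfolding arc_between_def by blast
  have inj: "inj_on \<gamma> {0..1}" and cont: "continuous_on {0..1} \<gamma>"
    using \<gamma>(1) by (auto simp: arc_def path_def)
  have "{0..1} - {0} = {0<..1::real}" by auto
  then have "S - {a} = \<gamma> ` {0<..1}"
    using \<gamma>(2,3) inj_on_image_set_diff[OF inj, of "{0..1}" "{0}"]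
    by (simp add: path_image_def pathstart_def)
       (metis atLeastAtMost_iff greaterThanAtMost_iff less_eq_real_def subsetI)
  moreover have "connected (\<gamma> ` {0<..1})"
    by (rule connected_continuous_image) (auto intro: continuous_on_subset[OF cont])
  ultimately show ?thesis by simp
qed

section \<open>Closed curves and theta curves\<close>

lemma Jordan_two_arcs:
  assumes "arc_between S a b" "arc_between T a b" "S \<inter> T = {a, b}"
  shows "inside (S \<union> T) \<noteq> {}" "connected (inside (S \<union> T))" "connected (outside (S \<union> T))"
    "frontier (inside (S \<union> T)) = S \<union> T"
proof -
  obtain \<gamma> \<delta> where "arc \<gamma>" "pathstart \<gamma> = a" "pathfinish \<gamma> = b" "path_image \<gamma> = S"
    "arc \<delta>" "pathstart \<delta> = b" "pathfinish \<delta> = a" "path_image \<delta> = T"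
    using assms(1) arc_between_sym[OF assms(2)] unfolding arc_between_def by blast
  with assms(3) have "simple_path (\<gamma> +++ \<delta>)" "pathfinish (\<gamma> +++ \<delta>) = pathstart (\<gamma> +++ \<delta>)"
    "path_image (\<gamma> +++ \<delta>) = S \<union> T"
    by (auto intro!: simple_path_join_loop simp: path_image_join)
  then show "inside (S \<union> T) \<noteq> {}" "connected (inside (S \<union> T))" "connected (outside (S \<union> T))"
    "frontier (inside (S \<union> T)) = S \<union> T"
    using Jordan_inside_outside[of "\<gamma> +++ \<delta>"] by auto
qed

lemma connected_subset_inside:
  fixes S :: "'a::euclidean_space set"
  assumes "closed S" "connected C" "C \<inter> S = {}" "C \<inter> inside S \<noteq> {}"
  shows "C \<subseteq> inside S"
proof -
  obtain x where x: "x \<in> C" "x \<in> inside S" using assms(4) by blast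
  show ?thesis
  proof
    fix y assume "y \<in> C"
    then have "connected_component (- S) x y"
      using assms(2,3) x(1) unfolding connected_component_def by blast
    then show "y \<in> inside S" using x(2) inside_same_component by blast
  qed
qed

text \<open>If no arc entered the inside of the other two, then \<open>A \<union> B\<close> and \<open>A \<union> C\<close>, which meet in
  the connected set \<open>A\<close>, would both fail to separate a point inside \<open>B \<union> C\<close> from infinity;
  by Janiszewski's theorem so would their union.\<close>

lemma theta_curve_cases:
  assumes A: "arc_between A a b" and B: "arc_between B a b" and C: "arc_between C a b"
    and AB: "A \<inter> B = {a, b}" and AC: "A \<inter> C = {a, b}" and BC: "B \<inter> C = {a, b}"
  shows "A \<inter> inside (B \<union> C) \<noteq> {} \<or> B \<inter> inside (A \<union> C) \<noteq> {} \<or> C \<inter> inside (A \<union> B) \<noteq> {}"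
proof (rule ccontr)
  assume "\<not> ?thesis"
  then have dA: "A \<inter> inside (B \<union> C) = {}" and dB: "B \<inter> inside (A \<union> C) = {}"
    and dC: "C \<inter> inside (A \<union> B) = {}" by auto
  note JA = Jordan_two_arcs[OF B C BC] and JB = Jordan_two_arcs[OF A C AC]
    and JC = Jordan_two_arcs[OF A B AB]
  have cpt: "compact A" "compact B" "compact C"
    using A B C by (auto intro: arc_between_compact)
  have cl: "closed (A \<union> B)" "closed (A \<union> C)" "closed (B \<union> C)"
    using cpt by (auto intro: compact_imp_closed)
  obtain x where x: "x \<in> inside (B \<union> C)" using JA(1) by blast
  \<comment> \<open>An arc is connected with two distinct ends, hence infinite. So no arc consists
    of \<open>a\<close> and \<open>b\<close> alone, and the closed curves compared below differ as
    sets.\<close>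
  have out_of: "D \<inter> {a, b} = D \<Longrightarrow> \<not> arc_between D a b" for D
  proof
    assume D: "D \<inter> {a, b} = D" "arc_between D a b"
    then have "finite D" by (metis finite.emptyI finite.insertI finite_Int)
    moreover have "connected D" "a \<in> D" "b \<in> D" "a \<noteq> b"
      using D(2) arc_between_ends arc_between_connected by blast+
    ultimately show False
      using connected_finite_iff_sing[of D] by auto
  qed
  have AneqB: "A \<union> C \<noteq> B \<union> C"
  proof
    assume "A \<union> C = B \<union> C"
    then have "A \<inter> {a, b} = A" using AB AC by blast
    then show False using A out_of by blast
  qed
  have AneqC: "A \<union> B \<noteq> B \<union> C"
  proof
    assume "A \<union> B = B \<union> C"
    then have "A \<inter> {a, b} = A" using AB AC by blast
    then show False using A out_of by blast
  qed
  \<comment> \<open>If both insides contained \<open>x\<close>, each would avoid the boundary of the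
    other, so they would coincide, and with them the two curves, which are their frontiers.\<close>
  have xAB: "x \<notin> inside (A \<union> B)"
  proof
    assume xi: "x \<in> inside (A \<union> B)"
    have "inside (B \<union> C) \<subseteq> inside (A \<union> B)"
      using cl x xi dA JA(2) inside_no_overlap[of "B \<union> C"] by (intro connected_subset_inside) blast+
    moreover have "inside (A \<union> B) \<subseteq> inside (B \<union> C)"
      using cl x xi dC JC(2) inside_no_overlap[of "A \<union> B"] by (intro connected_subset_inside) blast+
    ultimately show False using JA(4) JC(4) AneqC by auto
  qed
  have xAC: "x \<notin> inside (A \<union> C)"
  proof
    assume xi: "x \<in> inside (A \<union> C)"
    have "inside (B \<union> C) \<subseteq> inside (A \<union> C)"
      using cl x xi dA JA(2) inside_no_overlap[of "B \<union> C"] by (intro connected_subset_inside) blast+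
    moreover have "inside (A \<union> C) \<subseteq> inside (B \<union> C)"
      using cl x xi dB JB(2) inside_no_overlap[of "A \<union> C"] by (intro connected_subset_inside) blast+
    ultimately show False using JA(4) JB(4) AneqB by auto
  qed
  have xn: "x \<notin> A \<union> B \<union> C" using x dA inside_no_overlap[of "B \<union> C"] by blast
  have "outside (A \<union> B \<union> C) \<noteq> {}"
    using cpt by (intro outside_bounded_nonempty compact_imp_bounded compact_Un)
  then obtain y where y: "y \<in> outside (A \<union> B \<union> C)" by blast
  have yo: "y \<in> outside (A \<union> B)" "y \<in> outside (A \<union> C)" "y \<in> outside (B \<union> C)"
    using y outside_mono[of "A \<union> B" "A \<union> B \<union> C"] outside_mono[of "A \<union> C" "A \<union> B \<union> C"]
      outside_mono[of "B \<union> C" "A \<union> B \<union> C"] by blast+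
  have xo: "x \<in> outside (A \<union> B)" "x \<in> outside (A \<union> C)"
    using xAB xAC xn inside_Un_outside[of "A \<union> B"] inside_Un_outside[of "A \<union> C"] by blast+
  have "connected_component (- (A \<union> B)) x y" "connected_component (- (A \<union> C)) x y"
    using xo yo JC(3) JB(3) outside_no_overlap[of "A \<union> B"] outside_no_overlap[of "A \<union> C"]
    unfolding connected_component_def by blast+
  moreover have "(A \<union> B) \<inter> (A \<union> C) = A" using AB AC BC by blast
  ultimately have "connected_component (- ((A \<union> B) \<union> (A \<union> C))) x y"
    using Janiszewski[OF compact_Un[OF cpt(1,2)] cl(2)] arc_between_connected[OF A] by simp
  then have "connected_component (- (B \<union> C)) x y"
    by (rule connected_component_of_subset) blast
  then have "y \<in> inside (B \<union> C)" using x inside_same_component by blast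
  then show False using yo(3) inside_Int_outside by blast
qed

lemma theta_curve_split:
  assumes A: "arc_between A a b" and B: "arc_between B a b" and C: "arc_between C a b"
    and AB: "A \<inter> B = {a, b}" and AC: "A \<inter> C = {a, b}" and BC: "B \<inter> C = {a, b}"
    and "C \<inter> inside (A \<union> B) \<noteq> {}"
  shows "inside (A \<union> B) \<subseteq> inside (A \<union> C) \<union> inside (B \<union> C) \<union> C"
proof -
  obtain \<alpha> \<beta> \<gamma> where "arc \<alpha>" "pathstart \<alpha> = a" "pathfinish \<alpha> = b" "path_image \<alpha> = A"
    "arc \<beta>" "pathstart \<beta> = a" "pathfinish \<beta> = b" "path_image \<beta> = B"
    "arc \<gamma>" "pathstart \<gamma> = a" "pathfinish \<gamma> = b" "path_image \<gamma> = C"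
    using A B C unfolding arc_between_def by blast
  then show ?thesis
    using split_inside_simple_closed_curve[of \<alpha> a b \<beta> \<gamma>] assms arc_between_ends[OF A]
    by (auto simp: arc_imp_simple_path)
qed

text \<open>\<open>inside S\<close> is open and disjoint from \<open>outside T\<close>. In this form
  the outer face is used: no closed curve of the drawing encloses a vertex.\<close>

lemma closure_outside_not_inside:
  fixes S T :: "complex set"
  assumes "S \<subseteq> T" "closed S" "x \<in> closure (outside T)"
  shows "x \<notin> inside S"
proof
  assume "x \<in> inside S"
  then have "inside S \<inter> outside T \<noteq> {}"
    using assms(2,3) open_inside[of S] open_Int_closure_eq_empty by blast
  then show False using outside_mono[OF assms(1)] inside_Int_outside[of S] by blast
qed

text \<open>The chord \<open>A12\<close> cuts the inside of the 4-cycle 1-3-2-4 into two regions.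
  \<open>A34\<close> enters this inside without meeting \<open>A12\<close>, so apart from one end it
  stays in one region. The boundary of that region avoids the other end of \<open>A34\<close>, which
  is therefore an enclosed vertex.\<close>

lemma no_outer_plane_K4:
  assumes arcs: "arc_between A12 p1 p2" "arc_between A13 p1 p3" "arc_between A14 p1 p4"
      "arc_between A23 p2 p3" "arc_between A24 p2 p4" "arc_between A34 p3 p4"
    and adjacent: "A12 \<inter> A13 = {p1}" "A12 \<inter> A14 = {p1}" "A13 \<inter> A14 = {p1}"
      "A12 \<inter> A23 = {p2}" "A12 \<inter> A24 = {p2}" "A23 \<inter> A24 = {p2}"
      "A13 \<inter> A23 = {p3}" "A13 \<inter> A34 = {p3}" "A23 \<inter> A34 = {p3}"
      "A14 \<inter> A24 = {p4}" "A14 \<inter> A34 = {p4}" "A24 \<inter> A34 = {p4}"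
    and opposite: "A12 \<inter> A34 = {}" "A13 \<inter> A24 = {}" "A14 \<inter> A23 = {}"
    and sub: "A12 \<union> A13 \<union> A14 \<union> A23 \<union> A24 \<union> A34 \<subseteq> T"
    and outer: "{p1, p2, p3, p4} \<subseteq> closure (outside T)"
  shows False
proof -
  have Int_swap: "X \<inter> Y = Z \<Longrightarrow> Y \<inter> X = Z" for X Y Z :: "complex set" by blast
  note ints = adjacent opposite adjacent[THEN Int_swap] opposite[THEN Int_swap]
  note neq = arcs[THEN arc_between_ends(3)]
  note ends = arcs[THEN arc_between_ends(1)] arcs[THEN arc_between_ends(2)]
  have clo: "closed A12" "closed A13" "closed A14" "closed A23" "closed A24" "closed A34"
    using arcs by (auto intro: compact_imp_closed arc_between_compact)
  have not_in: "p \<notin> inside S" if "p \<in> {p1, p2, p3, p4}" "S \<subseteq> T" "closed S" for p S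
    using closure_outside_not_inside[OF that(2,3)] outer that(1) by blast
  \<comment> \<open>One 4-cycle in two decompositions: \<open>A \<union> B\<close> is cut at
    \<open>p1\<close> and \<open>p2\<close>, the ends of the chord \<open>A12\<close>, and
    \<open>A' \<union> B'\<close> at \<open>p3\<close> and \<open>p4\<close>, the ends of
    \<open>A34\<close>.\<close>
  define A where "A = A13 \<union> A23"
  define B where "B = A14 \<union> A24"
  define A' where "A' = A13 \<union> A14"
  define B' where "B' = A23 \<union> A24"
  have A: "arc_between A p1 p2" unfolding A_def
    using arc_between_join[OF arcs(2) arc_between_sym[OF arcs(4)] adjacent(7)] .
  have B: "arc_between B p1 p2" unfolding B_def
    using arc_between_join[OF arcs(3) arc_between_sym[OF arcs(5)] adjacent(10)] .
  have A': "arc_between A' p3 p4" unfolding A'_def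
    using arc_between_join[OF arc_between_sym[OF arcs(2)] arcs(3) adjacent(3)] .
  have B': "arc_between B' p3 p4" unfolding B'_def
    using arc_between_join[OF arc_between_sym[OF arcs(4)] arcs(5) adjacent(6)] .
  have int: "A \<inter> B = {p1, p2}" "A \<inter> A12 = {p1, p2}" "B \<inter> A12 = {p1, p2}"
    unfolding A_def B_def Int_Un_distrib Int_Un_distrib2 ints by auto
  have int': "A' \<inter> B' = {p3, p4}" "A' \<inter> A34 = {p3, p4}" "B' \<inter> A34 = {p3, p4}"
    unfolding A'_def B'_def Int_Un_distrib Int_Un_distrib2 ints by auto
  \<comment> \<open>Some arc of a theta curve enters the inside of the other two. It is not
    \<open>X\<close>: the open arc would lie inside as a whole, together with the outer vertex
    \<open>q\<close>. By \<open>r\<close> it is not \<open>Y\<close> either, so it is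
    \<open>C\<close>.\<close>
  have chord: "C \<inter> inside (X \<union> Y) \<noteq> {}"
    if X: "arc_between X a b" and Y: "arc_between Y a b" and C: "arc_between C a b"
      and XY: "X \<inter> Y = {a, b}" "X \<inter> C = {a, b}" "Y \<inter> C = {a, b}"
      and q: "q \<in> X - {a, b}" "q \<in> {p1, p2, p3, p4}" and r: "r \<in> Y - {a, b}" "r \<in> {p1, p2, p3, p4}"
      and T: "X \<union> Y \<union> C \<subseteq> T" for X Y C a b q r
  proof -
    have clX: "closed X" "closed Y" "closed C"
      using X Y C by (auto intro: compact_imp_closed arc_between_compact)
    have hit: "Z \<inter> inside (W \<union> C) = {}"
      if Z: "arc_between Z a b" "Z \<inter> W = {a, b}" "Z \<inter> C = {a, b}" "closed W" "W \<union> C \<subseteq> T"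
        and s: "s \<in> Z - {a, b}" "s \<in> {p1, p2, p3, p4}" for Z W s
    proof (rule ccontr)
      assume "Z \<inter> inside (W \<union> C) \<noteq> {}"
      then obtain z where z: "z \<in> Z" "z \<in> inside (W \<union> C)" by blast
      then have zab: "z \<notin> {a, b}" using Z inside_no_overlap[of "W \<union> C"] by blast
      obtain \<gamma> where \<gamma>: "arc \<gamma>" "pathstart \<gamma> = a" "pathfinish \<gamma> = b" "path_image \<gamma> = Z"
        using Z(1) unfolding arc_between_def by blast
      have "connected (Z - {a, b})"
        using connected_simple_path_endless[OF arc_imp_simple_path[OF \<gamma>(1)]] \<gamma> by simp
      then have "Z - {a, b} \<subseteq> inside (W \<union> C)"
        using z zab Z(2-4) clX by (intro connected_subset_inside) auto
      then show False using not_in[OF s(2) Z(5)] s(1) Z(4) clX by blast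
    qed
    have "X \<inter> inside (Y \<union> C) = {}"
      using hit[OF X XY(1,2) clX(2) _ q] T by blast
    moreover have "Y \<inter> inside (X \<union> C) = {}"
      using hit[OF Y Int_swap[OF XY(1)] XY(3) clX(1) _ r] T by blast
    ultimately show ?thesis using theta_curve_cases[OF X Y C XY] by blast
  qed
  have p: "p3 \<in> A - {p1, p2}" "p4 \<in> B - {p1, p2}" "p1 \<in> A' - {p3, p4}" "p2 \<in> B' - {p3, p4}"
    using ends neq unfolding A_def B_def A'_def B'_def by simp_all
  have sub': "A \<union> B \<union> A12 \<subseteq> T" "A' \<union> B' \<union> A34 \<subseteq> T"
    using sub unfolding A_def B_def A'_def B'_def by blast+
  have "A12 \<inter> inside (A \<union> B) \<noteq> {}"
    by (rule chord[OF A B arcs(1) int p(1) _ p(2) _ sub'(1)]) auto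
  then have split: "inside (A \<union> B) \<subseteq> inside (A \<union> A12) \<union> inside (B \<union> A12) \<union> A12"
    by (rule theta_curve_split[OF A B arcs(1) int])
  have "A34 \<inter> inside (A' \<union> B') \<noteq> {}"
    by (rule chord[OF A' B' arcs(6) int' p(3) _ p(4) _ sub'(2)]) auto
  moreover have "A' \<union> B' = A \<union> B" unfolding A_def B_def A'_def B'_def by blast
  ultimately obtain q where q: "q \<in> A34" "q \<in> inside (A \<union> B)" by auto
  have q': "q \<notin> A \<union> B" using q inside_no_overlap[of "A \<union> B"] by blast
  have cl: "closed (A \<union> A12)" "closed (B \<union> A12)" using clo unfolding A_def B_def by auto
  have sub'': "A \<union> A12 \<subseteq> T" "B \<union> A12 \<subseteq> T" using sub' by auto
  have "q \<in> inside (A \<union> A12) \<or> q \<in> inside (B \<union> A12)"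
    using split q opposite(1) by blast
  then show False
  proof
    assume "q \<in> inside (A \<union> A12)"
    moreover have "q \<in> A34 - {p3}" using q q' p by blast
    moreover have "(A34 - {p3}) \<inter> (A \<union> A12) = {}"
      unfolding A_def Diff_Int_distrib2 Int_Un_distrib ints using ends by simp
    ultimately have "A34 - {p3} \<subseteq> inside (A \<union> A12)"
      using cl arc_between_connected_minus_end[OF arcs(6)] by (intro connected_subset_inside) auto
    then have "p4 \<in> inside (A \<union> A12)" using arc_between_ends[OF arcs(6)] by blast
    then show False using not_in[OF _ sub''(1) cl(1), of p4] by blast
  next
    assume "q \<in> inside (B \<union> A12)"
    moreover have "q \<in> A34 - {p4}" using q q' p by blast
    moreover have "(A34 - {p4}) \<inter> (B \<union> A12) = {}"
      unfolding B_def Diff_Int_distrib2 Int_Un_distrib ints using ends by simp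
    ultimately have "A34 - {p4} \<subseteq> inside (B \<union> A12)"
      using cl arc_between_connected_minus_end[OF arc_between_sym[OF arcs(6)]]
      by (intro connected_subset_inside) auto
    then have "p3 \<in> inside (B \<union> A12)" using arc_between_ends[OF arcs(6)] by blast
    then show False using not_in[OF _ sub''(2) cl(2), of p3] by blast
  qed
qed

section \<open>Connected sets and minors\<close>

definition set_adj :: "('a \<times> 'a) set \<Rightarrow> 'a set \<Rightarrow> 'a set \<Rightarrow> bool" where
  "set_adj E A B \<longleftrightarrow> (\<exists>a\<in>A. \<exists>b\<in>B. (a, b) \<in> E)"

definition connected_in :: "('a \<times> 'a) set \<Rightarrow> 'a set \<Rightarrow> bool" where
  "connected_in E B \<longleftrightarrow> (\<forall>x\<in>B. \<forall>y\<in>B. (x, y) \<in> (E \<inter> B \<times> B)\<^sup>*)"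

text \<open>Nonempty sets need no clause of their own, since each set is adjacent to the others. The
  vertex type is left open because the notion is also applied to graphs whose vertices are branch
  sets.\<close>

definition K4_minor_sets :: "('a \<times> 'a) set \<Rightarrow> 'a set \<Rightarrow> 'a set \<Rightarrow> 'a set \<Rightarrow> 'a set \<Rightarrow> bool" where
  "K4_minor_sets E A B C D \<longleftrightarrow>
     connected_in E A \<and> connected_in E B \<and> connected_in E C \<and> connected_in E D \<and>
     A \<inter> B = {} \<and> A \<inter> C = {} \<and> A \<inter> D = {} \<and> B \<inter> C = {} \<and> B \<inter> D = {} \<and> C \<inter> D = {} \<and>
     set_adj E A B \<and> set_adj E A C \<and> set_adj E A D \<and> set_adj E B C \<and> set_adj E B D \<and> set_adj E C D"

lemma set_adj_sym: "sym E \<Longrightarrow> set_adj E A B \<Longrightarrow> set_adj E B A"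
  unfolding set_adj_def by (meson symE)

section \<open>Paths\<close>

definition path_list :: "('a \<times> 'a) set \<Rightarrow> 'a list \<Rightarrow> bool" where
  "path_list E xs \<longleftrightarrow> distinct xs \<and> successively (\<lambda>x y. (x, y) \<in> E) xs"

lemma path_list_Nil [simp]: "path_list E []"
  by (simp add: path_list_def)

lemma path_list_rev: "sym E \<Longrightarrow> path_list E (rev xs) \<longleftrightarrow> path_list E xs"
  unfolding path_list_def by (simp, metis (mono_tags, lifting) successively_mono symE)

lemma path_list_append:
  "path_list E (xs @ ys) \<longleftrightarrow> path_list E xs \<and> path_list E ys \<and> set xs \<inter> set ys = {} \<and>
     (xs \<noteq> [] \<longrightarrow> ys \<noteq> [] \<longrightarrow> (last xs, hd ys) \<in> E)"
  unfolding path_list_def by (auto simp: successively_append_iff)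

lemma path_list_Cons:
  "path_list E (x # xs) \<longleftrightarrow> path_list E xs \<and> x \<notin> set xs \<and> (xs \<noteq> [] \<longrightarrow> (x, hd xs) \<in> E)"
  unfolding path_list_def by (auto simp: successively_Cons)

lemma connected_in_path_list:
  assumes "sym E" "path_list E xs"
  shows "connected_in E (set xs)"
proof -
  have "(x, y) \<in> (E \<inter> set xs \<times> set xs)\<^sup>*" if "x \<in> set xs" "y \<in> set xs" for x y
    using assms(2) that
  proof (induction xs arbitrary: x y)
    case (Cons z zs)
    let ?R = "E \<inter> set zs \<times> set zs" and ?R' = "E \<inter> set (z # zs) \<times> set (z # zs)"
    have mono: "?R\<^sup>* \<subseteq> ?R'\<^sup>*" by (rule rtrancl_mono) auto
    have sym': "sym (?R'\<^sup>*)" using assms(1) by (intro sym_rtrancl) (auto simp: sym_def)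
    have to: "(z, w) \<in> ?R'\<^sup>*" if "w \<in> set (z # zs)" for w
    proof (cases "w = z")
      case False
      then have w: "w \<in> set zs" "zs \<noteq> []" using that by auto
      then have "(hd zs, w) \<in> ?R\<^sup>*" using Cons by (simp add: path_list_Cons)
      moreover have "(z, hd zs) \<in> ?R'" using Cons.prems(1) w by (simp add: path_list_Cons)
      ultimately show ?thesis using mono by (meson converse_rtrancl_into_rtrancl subsetD)
    qed simp
    then show ?case using Cons.prems sym' by (meson rtrancl_trans symE)
  qed simp
  then show ?thesis unfolding connected_in_def by blast
qed

lemma connected_in_path_list_exists:
  assumes "connected_in E B" "x \<in> B" "y \<in> B"
  obtains xs where "path_list E xs" "xs \<noteq> []" "hd xs = x" "last xs = y" "set xs \<subseteq> B"
proof -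
  have "(x, y) \<in> (E \<inter> B \<times> B)\<^sup>*" using assms unfolding connected_in_def by blast
  then have "\<exists>xs. path_list E xs \<and> xs \<noteq> [] \<and> hd xs = x \<and> last xs = y \<and> set xs \<subseteq> B"
    using assms(2)
  proof (induction rule: converse_rtrancl_induct)
    case base
    then show ?case by (intro exI[of _ "[y]"]) (simp add: path_list_def)
  next
    case (step x z)
    then obtain xs where xs: "path_list E xs" "xs \<noteq> []" "hd xs = z" "last xs = y" "set xs \<subseteq> B"
      by blast
    show ?case
    \<comment> \<open>If the path already visits \<open>x\<close>, everything before that visit is
      dropped, which keeps the vertices distinct.\<close>
    proof (cases "x \<in> set xs")
      case True
      then obtain us vs where "xs = us @ x # vs" by (meson split_list)
      with xs show ?thesis
        by (intro exI[of _ "x # vs"]) (auto simp: path_list_append)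
    next
      case False
      with xs step show ?thesis
        by (intro exI[of _ "x # xs"]) (auto simp: path_list_Cons)
    qed
  qed
  then show ?thesis using that by blast
qed

section \<open>A graph of minimum degree three has a \<open>K\<^sub>4\<close> minor\<close>

text \<open>The path is cut into four consecutive segments, which gives three of the six
  adjacencies. The edges from \<open>hd P\<close> to \<open>q\<close> and to \<open>j\<close> and
  from \<open>last P\<close> to \<open>m\<close> give the other three;
  \<open>length P \<ge> 2\<close> puts \<open>last P\<close> into the second segment.\<close>

lemma K4_minor_of_crossing:
  assumes E: "sym E" and PQ: "path_list E (P @ q # Q1 @ m # Q2)" "length P \<ge> 2"
    and "(hd P, q) \<in> E" "(last P, m) \<in> E" "j \<in> set (m # Q2)" "(hd P, j) \<in> E"
  shows "K4_minor_sets E {hd P} (set (tl P)) (set (q # Q1)) (set (m # Q2))"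
proof -
  obtain a b P' where P: "P = a # b # P'"
    using PQ(2) by (metis Suc_le_length_iff numeral_2_eq_2)
  have *: "path_list E [a]" "path_list E (b # P')" "path_list E (q # Q1)" "path_list E (m # Q2)"
    using PQ(1) unfolding P by (auto simp: path_list_append path_list_Cons)
  have adj: "(last P, q) \<in> E" "(last (q # Q1), m) \<in> E" "(a, b) \<in> E"
    using PQ(1) path_list_append[of E P "q # Q1 @ m # Q2"]
      path_list_append[of E "P @ q # Q1" "m # Q2"] P by (auto simp: path_list_Cons)
  have dist: "distinct (P @ q # Q1 @ m # Q2)" using PQ(1) unfolding path_list_def by blast
  have last: "last P \<in> set (b # P')" unfolding P by simp
  have conn: "connected_in E {a}" "connected_in E (set (b # P'))" "connected_in E (set (q # Q1))"
    "connected_in E (set (m # Q2))"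
    using *[THEN connected_in_path_list[OF E]] by simp_all
  have "set_adj E {a} (set (b # P'))" "set_adj E {a} (set (q # Q1))" "set_adj E {a} (set (m # Q2))"
    "set_adj E (set (b # P')) (set (q # Q1))" "set_adj E (set (b # P')) (set (m # Q2))"
    "set_adj E (set (q # Q1)) (set (m # Q2))"
    unfolding set_adj_def using adj assms(4-7) last P
    by (metis insertI1 last_in_set list.distinct(1) list.sel(1) list.set_intros(1))+
  then show ?thesis using conn dist unfolding K4_minor_sets_def P by auto
qed

lemma longest_path_list:
  assumes "finite S" "x \<in> S"
  obtains xs where "path_list E xs" "set xs \<subseteq> S" "xs \<noteq> []"
    "\<And>ys. path_list E ys \<Longrightarrow> set ys \<subseteq> S \<Longrightarrow> length ys \<le> length xs"
proof -
  let ?Q = "\<lambda>xs. path_list E xs \<and> set xs \<subseteq> S"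
  have len: "length xs \<le> card S" if "?Q xs" for xs
    using that assms(1) by (metis card_mono distinct_card path_list_def)
  have single: "?Q [x]" using assms by (simp add: path_list_def)
  obtain xs where xs: "?Q xs" "\<forall>ys. ?Q ys \<longrightarrow> length ys \<le> length xs"
    using ex_has_greatest_nat[of ?Q "[x]" length "Suc (card S)"] single len
    by (metis less_Suc_eq_le)
  moreover have "xs \<noteq> []" using xs(2) single by fastforce
  ultimately show ?thesis using that by blast
qed

text \<open>Take a longest path \<open>P @ Q\<close> whose first vertex is adjacent to \<open>hd Q\<close>, with \<open>P\<close> as short as
  possible. Then \<open>rev P @ Q\<close> is another such path, so by minimality both ends of \<open>P\<close> have a neighbor
  in \<open>tl Q\<close>, which gives two crossing chords.\<close>

lemma min_degree_3_K4_minor: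
  assumes E: "sym E" "irrefl E" and S: "finite S" "S \<noteq> {}"
    and deg: "\<And>v. v \<in> S \<Longrightarrow> card {w \<in> S. (v, w) \<in> E} \<ge> 3"
  obtains A B C D where "K4_minor_sets E A B C D" "A \<subseteq> S" "B \<subseteq> S" "C \<subseteq> S" "D \<subseteq> S"
proof -
  obtain x where "x \<in> S" using S by blast
  then obtain M where M: "path_list E M" "set M \<subseteq> S" "M \<noteq> []"
    and Mmax: "\<And>ys. path_list E ys \<Longrightarrow> set ys \<subseteq> S \<Longrightarrow> length ys \<le> length M"
    using longest_path_list[OF S(1)] by metis
  have third: "\<exists>w\<in>S. (v, w) \<in> E \<and> w \<noteq> a \<and> w \<noteq> b" if "v \<in> S" for v a b
  proof (rule ccontr)
    assume "\<not> ?thesis"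
    then have "{w \<in> S. (v, w) \<in> E} \<subseteq> {a, b}" by blast
    then have "card {w \<in> S. (v, w) \<in> E} \<le> card {a, b}" by (rule card_mono[rotated]) simp
    also have "\<dots> \<le> 2" by (simp add: card_insert_if)
    finally show False using deg[OF that] by linarith
  qed
  define longest where "longest xs \<longleftrightarrow> path_list E xs \<and> set xs \<subseteq> S \<and> length xs = length M" for xs
  have on_path: "w \<in> set xs" if "longest xs" "w \<in> S" "(hd xs, w) \<in> E" for xs w
  proof (rule ccontr)
    assume "w \<notin> set xs"
    then have "path_list E (w # xs)" "set (w # xs) \<subseteq> S"
      using that E(1) unfolding longest_def by (auto simp: path_list_Cons dest: symD)
    then show False using Mmax[of "w # xs"] that(1) unfolding longest_def by simp
  qed
  \<comment> \<open>\<open>P\<close> and \<open>hd Q\<close> form a cycle to which the rest of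
    \<open>Q\<close> is attached. The length bound excludes the edge from the first vertex of the
    path to the second, which gives no cycle.\<close>
  define lollipop where "lollipop P Q \<longleftrightarrow> longest (P @ Q) \<and> Q \<noteq> [] \<and> length P \<ge> 2 \<and> (hd P, hd Q) \<in> E" for P Q
  have position: "length us \<ge> 2"
    if "xs = us @ w # vs" "(hd xs, w) \<in> E" "w \<noteq> hd (tl xs)" for xs us w vs
  proof (rule ccontr)
    assume "\<not> ?thesis"
    then have "us = [] \<or> (\<exists>u. us = [u])" by (cases us rule: remdups_adj.cases) auto
    then show False using that E(2) by (auto simp: irrefl_def)
  qed
  have "\<exists>P Q. lollipop P Q"
  proof -
    have lM: "longest M" using M unfolding longest_def by blast
    have "hd M \<in> S" using M by auto
    \<comment> \<open>If \<open>M\<close> has a single vertex, \<open>hd (tl M)\<close> is an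
      unspecified value, which is harmless as \<open>third\<close> may exclude any two
      vertices.\<close>
    from third[OF this, of "hd (tl M)" "hd (tl M)"]
    obtain w where w: "w \<in> S" "(hd M, w) \<in> E" "w \<noteq> hd (tl M)" by blast
    have "w \<in> set M" using on_path[OF lM w(1,2)] .
    then obtain us vs where M_eq: "M = us @ w # vs" by (meson split_list)
    have "length us \<ge> 2" using position[OF M_eq w(2,3)] .
    then have "lollipop us (w # vs)" using lM w(2) unfolding lollipop_def M_eq by (cases us) auto
    then show ?thesis by blast
  qed
  then obtain n where "\<exists>P Q. lollipop P Q \<and> length P = n" by blast
  then obtain P Q where PQ: "lollipop P Q"
    and min: "\<And>P' Q'. lollipop P' Q' \<Longrightarrow> length P \<le> length P'"
    using exists_least_iff[of "\<lambda>n. \<exists>P Q. lollipop P Q \<and> length P = n"] by (metis not_le)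
  have lolli_rev: "lollipop (rev P) Q"
  proof -
    have "P \<noteq> []" using PQ unfolding lollipop_def by auto
    then show ?thesis
      using PQ E(1) unfolding lollipop_def longest_def
      by (auto simp: path_list_append path_list_rev hd_rev last_rev)
  qed
  obtain q Q' where Q: "Q = q # Q'" using PQ unfolding lollipop_def by (cases Q) auto
  \<comment> \<open>Besides its successor \<open>b\<close> and the vertex \<open>q\<close>, the
    first vertex has a third neighbor. It lies on the path, as the path is longest, and not in
    \<open>R\<close>, where it would close a shorter cycle.\<close>
  have far: "\<exists>w\<in>set Q'. (hd R, w) \<in> E" if R: "lollipop R Q" "length R = length P" for R
  proof -
    have R2: "length R \<ge> 2" and lR: "longest (R @ Q)" using R unfolding lollipop_def by blast+
    then obtain a b R' where R_eq: "R = a # b # R'"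
      by (metis Suc_le_length_iff numeral_2_eq_2)
    have "a \<in> S" using lR unfolding longest_def R_eq by simp
    from third[OF this, of b q] obtain w where w: "w \<in> S" "(a, w) \<in> E" "w \<noteq> b" "w \<noteq> q" by blast
    have "w \<in> set (R @ Q)" using on_path[OF lR w(1)] w(2) unfolding R_eq by simp
    moreover have "w \<notin> set R"
    proof
      assume "w \<in> set R"
      then obtain us vs where us: "R = us @ w # vs" by (meson split_list)
      have "length us \<ge> 2" using position[OF us] w R_eq by simp
      moreover from this have "hd us = a" using us R_eq by (cases us) auto
      ultimately have "lollipop us (w # vs @ Q)"
        using lR w(2) unfolding lollipop_def us by simp
      then show False using min R(2) us by fastforce
    qed
    ultimately show ?thesis using w Q R_eq by auto
  qed
  have finish: "\<exists>A B C D. K4_minor_sets E A B C D \<and> A \<subseteq> S \<and> B \<subseteq> S \<and> C \<subseteq> S \<and> D \<subseteq> S"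
    if R: "lollipop R Q" and m: "Q' = Q1 @ m # Q2" "(last R, m) \<in> E"
      and j: "j \<in> set (m # Q2)" "(hd R, j) \<in> E" for R Q1 m Q2 j
  proof -
    have "path_list E (R @ q # Q1 @ m # Q2)" "length R \<ge> 2" "(hd R, q) \<in> E"
      and sub: "set (R @ q # Q1 @ m # Q2) \<subseteq> S"
      using R unfolding lollipop_def longest_def Q m(1) by auto
    then have "K4_minor_sets E {hd R} (set (tl R)) (set (q # Q1)) (set (m # Q2))"
      using K4_minor_of_crossing[OF E(1)] m j by blast
    moreover have "hd R \<in> S" "set (tl R) \<subseteq> S"
      using sub \<open>length R \<ge> 2\<close> by (cases R; auto)+
    ultimately show ?thesis using sub by fastforce
  qed
  obtain j where j: "j \<in> set Q'" "(hd P, j) \<in> E" using far[OF PQ] by blast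
  have "P \<noteq> []" using PQ unfolding lollipop_def by auto
  then obtain m where m: "m \<in> set Q'" "(last P, m) \<in> E"
    using far[OF lolli_rev] by (auto simp: hd_rev)
  obtain Q1 Q2 where Qm: "Q' = Q1 @ m # Q2" using m(1) by (meson split_list)
  have "\<exists>A B C D. K4_minor_sets E A B C D \<and> A \<subseteq> S \<and> B \<subseteq> S \<and> C \<subseteq> S \<and> D \<subseteq> S"
  proof (cases "j \<in> set (m # Q2)")
    case True
    then show ?thesis using finish[OF PQ Qm] m j by blast
  next
    \<comment> \<open>Here the neighbor \<open>j\<close> of \<open>hd P\<close> precedes the
      neighbor \<open>m\<close> of \<open>last P\<close>. Reversing \<open>P\<close> exchanges their
      roles, and the chords cross as required.\<close>
    case False
    then have "j \<in> set Q1" using j Qm by auto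
    then obtain R1 R2 where "Q1 = R1 @ j # R2" by (meson split_list)
    then have "Q' = R1 @ j # (R2 @ m # Q2)" using Qm by simp
    from finish[OF lolli_rev this, of m] show ?thesis
      using m j \<open>P \<noteq> []\<close> by (auto simp: hd_rev last_rev)
  qed
  then show ?thesis using that by blast
qed

section \<open>Branch sets\<close>

text \<open>An induced minor: each member is contracted to a vertex, and vertices outside all
  members are deleted. Since minors are families of subsets of one fixed graph, an automorphism acts
  on them by taking images.\<close>

definition branch_family :: "('a \<times> 'a) set \<Rightarrow> 'a set set \<Rightarrow> bool" where
  "branch_family E \<B> \<longleftrightarrow> finite \<B> \<and> disjoint \<B> \<and> {} \<notin> \<B> \<and> (\<forall>B\<in>\<B>. connected_in E B)"

text \<open>Contracted edges have both ends in one branch set and leave no trace here. Loops that a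
  contraction creates are therefore invisible to this relation and are split off as a case in
  \<open>invariant_colorings_poly\<close>.\<close>

definition branch_adj :: "('a \<times> 'a) set \<Rightarrow> 'a set \<Rightarrow> 'a set \<Rightarrow> bool" where
  "branch_adj E A B \<longleftrightarrow> A \<noteq> B \<and> set_adj E A B"

lemma connected_in_Union:
  assumes B: "\<And>B. B \<in> \<A> \<Longrightarrow> connected_in E B \<and> B \<noteq> {}"
    and conn: "connected_in {(X, Y). branch_adj E X Y} \<A>"
  shows "connected_in E (\<Union>\<A>)"
proof -
  let ?R = "E \<inter> \<Union>\<A> \<times> \<Union>\<A>"
  have inner: "(x, y) \<in> ?R\<^sup>*" if "X \<in> \<A>" "x \<in> X" "y \<in> X" for X x y
  proof -
    have "(x, y) \<in> (E \<inter> X \<times> X)\<^sup>*" using B that unfolding connected_in_def by blast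
    moreover have "(E \<inter> X \<times> X)\<^sup>* \<subseteq> ?R\<^sup>*" using that(1) by (intro rtrancl_mono) blast
    ultimately show ?thesis by blast
  qed
  have "(x, y) \<in> ?R\<^sup>*" if X: "X \<in> \<A>" and Y: "Y \<in> \<A>" and x: "x \<in> X" and y: "y \<in> Y" for X Y x y
  proof -
    have "(X, Y) \<in> ({(X, Y). branch_adj E X Y} \<inter> \<A> \<times> \<A>)\<^sup>*"
      using conn X Y unfolding connected_in_def by blast
    then show ?thesis using y
    proof (induction arbitrary: y rule: rtrancl_induct)
      case base
      then show ?case using inner X x by blast
    next
      case (step Y Z)
      then obtain a b where ab: "a \<in> Y" "b \<in> Z" "(a, b) \<in> E" "Y \<in> \<A>" "Z \<in> \<A>"
        unfolding branch_adj_def set_adj_def by blast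
      then have "(x, a) \<in> ?R\<^sup>*" "(a, b) \<in> ?R" "(b, y) \<in> ?R\<^sup>*"
        using step inner by blast+
      then show ?case by (meson rtrancl.rtrancl_into_rtrancl rtrancl_trans)
    qed
  qed
  then show ?thesis unfolding connected_in_def by blast
qed

text \<open>A minor of a minor is a minor: minimum degree 3 would force a K4 minor among the branch
  sets, and unions of branch sets turn it into one of the original graph.\<close>

lemma branch_of_degree_le_2:
  assumes E: "sym E" and no_K4: "\<And>A B C D. \<not> K4_minor_sets E A B C D"
    and \<B>: "branch_family E \<B>" "\<B> \<noteq> {}"
  shows "\<exists>B\<in>\<B>. card {A \<in> \<B>. branch_adj E B A} \<le> 2"
proof (rule ccontr)
  assume "\<not> ?thesis"
  then have deg: "card {w \<in> \<B>. (v, w) \<in> {(X, Y). branch_adj E X Y}} \<ge> 3" if "v \<in> \<B>" for v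
    using that by fastforce
  have "sym {(X, Y). branch_adj E X Y}" "irrefl {(X, Y). branch_adj E X Y}"
    using set_adj_sym[OF E] by (auto simp: sym_def irrefl_def branch_adj_def)
  then obtain A B C D where K4: "K4_minor_sets {(X, Y). branch_adj E X Y} A B C D"
    and sub: "A \<subseteq> \<B>" "B \<subseteq> \<B>" "C \<subseteq> \<B>" "D \<subseteq> \<B>"
    using min_degree_3_K4_minor[OF _ _ _ \<B>(2) deg] \<B>(1) unfolding branch_family_def by metis
  have conn: "connected_in E (\<Union>\<A>)"
    if "connected_in {(X, Y). branch_adj E X Y} \<A>" "\<A> \<subseteq> \<B>" for \<A>
    using \<B>(1) that by (intro connected_in_Union) (auto simp: branch_family_def)
  have dis: "\<Union>\<A> \<inter> \<Union>\<A>' = {}" if "\<A> \<inter> \<A>' = {}" "\<A> \<subseteq> \<B>" "\<A>' \<subseteq> \<B>" for \<A> \<A>'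
  proof (rule ccontr)
    assume "\<Union>\<A> \<inter> \<Union>\<A>' \<noteq> {}"
    then obtain X Y where "X \<in> \<A>" "Y \<in> \<A>'" "X \<inter> Y \<noteq> {}" by blast
    then show False using \<B>(1) that unfolding branch_family_def by (metis IntI disjointD empty_iff subsetD)
  qed
  have adj: "set_adj E (\<Union>\<A>) (\<Union>\<A>')" if "set_adj {(X, Y). branch_adj E X Y} \<A> \<A>'" for \<A> \<A>'
    using that unfolding branch_adj_def set_adj_def by blast
  have "K4_minor_sets E (\<Union>A) (\<Union>B) (\<Union>C) (\<Union>D)"
    using K4 sub conn dis adj unfolding K4_minor_sets_def by simp
  then show False using no_K4 by blast
qed

section \<open>From a \<open>K\<^sub>4\<close> minor to a plane \<open>K\<^sub>4\<close>\<close>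

text \<open>Each vertex of K4 has degree 3, so within a branch set only three exits must be joined.
  Take a path from \<open>x\<close> to \<open>y\<close> and follow a path from \<open>z\<close>
  towards \<open>x\<close> until it first meets the former, at \<open>c\<close>. A leg may be empty,
  as \<open>c\<close> may be an exit.\<close>

lemma tripod:
  assumes E: "sym E" and B: "connected_in E B" "x \<in> B" "y \<in> B" "z \<in> B"
  obtains c xs ys zs where "path_list E (c # xs)" "path_list E (c # ys)" "path_list E (c # zs)"
    "last (c # xs) = x" "last (c # ys) = y" "last (c # zs) = z"
    "set (c # xs) \<subseteq> B" "set (c # ys) \<subseteq> B" "set (c # zs) \<subseteq> B"
    "set xs \<inter> set ys = {}" "set xs \<inter> set zs = {}" "set ys \<inter> set zs = {}"
proof -
  obtain P where P: "path_list E P" "P \<noteq> []" "hd P = x" "last P = y" "set P \<subseteq> B"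
    using connected_in_path_list_exists[OF B(1-3)] by metis
  obtain R where R: "path_list E R" "R \<noteq> []" "hd R = z" "last R = x" "set R \<subseteq> B"
    using connected_in_path_list_exists[OF B(1,4,2)] by metis
  have "\<exists>c\<in>set R. c \<in> set P" using P R by (metis hd_in_set last_in_set)
  then obtain R1 c R2 where R_eq: "R = R1 @ c # R2" and c: "c \<in> set P" and R1: "\<forall>r\<in>set R1. r \<notin> set P"
    using split_list_first_prop[of R "\<lambda>c. c \<in> set P"] by blast
  obtain P1 P2 where P_eq: "P = P1 @ c # P2" using c by (meson split_list)
  have rev_Cons: "path_list E (c # rev Q)" if "path_list E (Q @ c # Q')" for Q Q'
  proof -
    have "path_list E (Q @ [c])" using that by (auto simp: path_list_append path_list_Cons)
    then show ?thesis using path_list_rev[OF E, of "Q @ [c]"] by simp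
  qed
  show ?thesis
  proof (rule that[of c "rev P1" P2 "rev R1"])
    show "path_list E (c # rev P1)" "path_list E (c # rev R1)"
      using rev_Cons P(1) R(1) unfolding P_eq R_eq by blast+
    show "path_list E (c # P2)" using P(1) unfolding P_eq path_list_append by blast
    show "last (c # rev P1) = x" using P(3) unfolding P_eq by (cases P1) (auto simp: last_rev)
    show "last (c # P2) = y" using P(4) unfolding P_eq by simp
    show "last (c # rev R1) = z" using R(3) unfolding R_eq by (cases R1) (auto simp: last_rev)
    show "set (c # rev P1) \<subseteq> B" "set (c # P2) \<subseteq> B" using P(5) unfolding P_eq by auto
    show "set (c # rev R1) \<subseteq> B" using R(5) unfolding R_eq by auto
    show "set (rev P1) \<inter> set P2 = {}" using P(1) unfolding P_eq path_list_def by auto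
    show "set (rev P1) \<inter> set (rev R1) = {}" "set P2 \<inter> set (rev R1) = {}"
      using R1 unfolding P_eq by auto
  qed
qed

text \<open>Only edges are drawn, so a path of one vertex yields the empty set and not a
  point.\<close>

definition path_drawing :: "('a set \<Rightarrow> real \<Rightarrow> complex) \<Rightarrow> 'a list \<Rightarrow> complex set" where
  "path_drawing \<gamma> xs = (\<Union>(u, v) \<in> set (zip xs (tl xs)). path_image (\<gamma> {u, v}))"

lemma path_list_zip_arcs: "path_list E xs \<Longrightarrow> set (zip xs (tl xs)) \<subseteq> E"
proof (induction xs)
  case (Cons x xs)
  then show ?case by (cases xs) (auto simp: path_list_Cons)
qed simp

lemma set_zip_tl_subset: "set (zip xs (tl xs)) \<subseteq> set xs \<times> set xs"
  by (cases xs) (auto dest: set_zip_leftD set_zip_rightD)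

context
  fixes \<Gamma> :: "'a pair_pre_digraph" and p :: "'a \<Rightarrow> complex" and \<gamma>
  assumes graph: "pair_graph \<Gamma>" and drawing: "plane_drawing \<Gamma> p \<gamma>"
begin

text \<open>Without loops, paths with at most one common vertex have no common edge, and distinct
  edges of a plane drawing meet only in common ends.\<close>

lemma path_drawing_Int:
  assumes "path_list (parcs \<Gamma>) xs" "path_list (parcs \<Gamma>) ys" "set xs \<inter> set ys \<subseteq> {c}"
  shows "path_drawing \<gamma> xs \<inter> path_drawing \<gamma> ys \<subseteq> p ` (set xs \<inter> set ys)"
proof
  fix z assume "z \<in> path_drawing \<gamma> xs \<inter> path_drawing \<gamma> ys"
  then obtain u v u' v' where uv: "(u, v) \<in> set (zip xs (tl xs))" "z \<in> path_image (\<gamma> {u, v})"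
    and uv': "(u', v') \<in> set (zip ys (tl ys))" "z \<in> path_image (\<gamma> {u', v'})"
    unfolding path_drawing_def by auto
  have arcs: "(u, v) \<in> parcs \<Gamma>" "(u', v') \<in> parcs \<Gamma>"
    using path_list_zip_arcs assms uv uv' by blast+
  have sets: "{u, v} \<subseteq> set xs" "{u', v'} \<subseteq> set ys"
    using set_zip_tl_subset[of xs] set_zip_tl_subset[of ys] uv uv' by blast+
  interpret pair_graph \<Gamma> by (rule graph)
  have "u \<noteq> v" using no_loops' arcs by blast
  have "{u, v} \<noteq> {u', v'}"
  proof
    assume "{u, v} = {u', v'}"
    then have "{u, v} \<subseteq> {c}" using sets assms(3) by (metis le_inf_iff subset_trans)
    then show False using \<open>u \<noteq> v\<close> by blast
  qed
  then have "z \<in> p ` ({u, v} \<inter> {u', v'})"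
    using drawing arcs uv uv' unfolding plane_drawing_def by blast
  then show "z \<in> p ` (set xs \<inter> set ys)" using sets by blast
qed

lemma arc_between_edge:
  assumes "(u, v) \<in> parcs \<Gamma>"
  shows "arc_between (path_image (\<gamma> {u, v})) (p u) (p v)"
proof -
  have a: "arc (\<gamma> {u, v})" "{pathstart (\<gamma> {u, v}), pathfinish (\<gamma> {u, v})} = {p u, p v}"
    using conjunct1[OF conjunct2[OF drawing[unfolded plane_drawing_def]]] assms by auto
  then have "arc_between (path_image (\<gamma> {u, v})) (pathstart (\<gamma> {u, v})) (pathfinish (\<gamma> {u, v}))"
    unfolding arc_between_def by blast
  then show ?thesis using a(2) arc_between_sym by (auto simp: doubleton_eq_iff)
qed

lemma arc_between_path_drawing:
  assumes "path_list (parcs \<Gamma>) xs" "length xs \<ge> 2"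
  shows "arc_between (path_drawing \<gamma> xs) (p (hd xs)) (p (last xs))"
  using assms
proof (induction xs)
  case (Cons x xs)
  then obtain y ys where xs: "xs = y # ys" by (cases xs) auto
  have e: "arc_between (path_image (\<gamma> {x, y})) (p x) (p y)"
    using Cons.prems xs by (intro arc_between_edge) (simp add: path_list_Cons)
  have xy: "path_drawing \<gamma> [x, y] = path_image (\<gamma> {x, y})" by (simp add: path_drawing_def)
  show ?case
  \<comment> \<open>A single edge is treated apart because \<open>path_drawing \<gamma> [y]\<close>
    is empty instead of \<open>{p y}\<close>.\<close>
  proof (cases ys)
    case Nil
    then show ?thesis using e xy xs by simp
  next
    case (Cons z zs)
    have IH: "arc_between (path_drawing \<gamma> xs) (p y) (p (last xs))"
      using Cons.IH Cons.prems xs Cons by (simp add: path_list_Cons)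
    have "path_drawing \<gamma> [x, y] \<inter> path_drawing \<gamma> xs \<subseteq> p ` (set [x, y] \<inter> set xs)"
      using Cons.prems xs by (intro path_drawing_Int[where c = y]) (auto simp: path_list_Cons)
    also have "\<dots> \<subseteq> {p y}" using Cons.prems xs by (auto simp: path_list_Cons)
    finally have "path_image (\<gamma> {x, y}) \<inter> path_drawing \<gamma> xs = {p y}"
      using arc_between_ends[OF IH] arc_between_ends[OF e] xy by auto
    from arc_between_join[OF e IH this] show ?thesis using xs by (simp add: path_drawing_def)
  qed
qed simp

lemma path_drawing_subset:
  assumes "path_list (parcs \<Gamma>) xs"
  shows "path_drawing \<gamma> xs \<subseteq> drawing_image \<Gamma> p \<gamma>"
  using path_list_zip_arcs[OF assms] unfolding path_drawing_def drawing_image_def by blast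

text \<open>The tripod centers of the four branch sets become the vertices of a plane K4. Two
  centers are linked by a leg, the edge between the branch sets, and a reversed leg; any two of the
  six links share at most a center.\<close>

lemma no_outer_K4_minor:
  assumes outer: "p ` pverts \<Gamma> \<subseteq> frontier (outside (drawing_image \<Gamma> p \<gamma>))"
  shows "\<not> K4_minor_sets (parcs \<Gamma>) A B C D"
proof
  let ?E = "parcs \<Gamma>"
  assume K4: "K4_minor_sets ?E A B C D"
  interpret pair_graph \<Gamma> by (rule graph)
  have E: "sym ?E" using pair_sym_arcs by (simp add: symmetric_def)
  have conn: "connected_in ?E A" "connected_in ?E B" "connected_in ?E C" "connected_in ?E D"
    and disj: "A \<inter> B = {}" "A \<inter> C = {}" "A \<inter> D = {}" "B \<inter> C = {}" "B \<inter> D = {}" "C \<inter> D = {}"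
    and adj: "set_adj ?E A B" "set_adj ?E A C" "set_adj ?E A D" "set_adj ?E B C" "set_adj ?E B D"
      "set_adj ?E C D"
    using K4 unfolding K4_minor_sets_def by simp_all
  obtain ab ba where ab: "ab \<in> A" "ba \<in> B" "(ab, ba) \<in> ?E" using adj(1) unfolding set_adj_def by blast
  obtain ac ca where ac: "ac \<in> A" "ca \<in> C" "(ac, ca) \<in> ?E" using adj(2) unfolding set_adj_def by blast
  obtain ad da where ad: "ad \<in> A" "da \<in> D" "(ad, da) \<in> ?E" using adj(3) unfolding set_adj_def by blast
  obtain bc cb where bc: "bc \<in> B" "cb \<in> C" "(bc, cb) \<in> ?E" using adj(4) unfolding set_adj_def by blast
  obtain bd db where bd: "bd \<in> B" "db \<in> D" "(bd, db) \<in> ?E" using adj(5) unfolding set_adj_def by blast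
  obtain cd dc where cd: "cd \<in> C" "dc \<in> D" "(cd, dc) \<in> ?E" using adj(6) unfolding set_adj_def by blast
  have disj': "B \<inter> A = {}" "C \<inter> A = {}" "D \<inter> A = {}" "C \<inter> B = {}" "D \<inter> B = {}" "D \<inter> C = {}"
    using disj by blast+
  obtain a AB AC AD where a: "path_list ?E (a # AB)" "path_list ?E (a # AC)" "path_list ?E (a # AD)"
    "last (a # AB) = ab" "last (a # AC) = ac" "last (a # AD) = ad"
    "set (a # AB) \<subseteq> A" "set (a # AC) \<subseteq> A" "set (a # AD) \<subseteq> A"
    "set AB \<inter> set AC = {}" "set AB \<inter> set AD = {}" "set AC \<inter> set AD = {}"
    by (rule tripod[OF E conn(1) ab(1) ac(1) ad(1)])
  obtain b BA BC BD where b: "path_list ?E (b # BA)" "path_list ?E (b # BC)" "path_list ?E (b # BD)"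
    "last (b # BA) = ba" "last (b # BC) = bc" "last (b # BD) = bd"
    "set (b # BA) \<subseteq> B" "set (b # BC) \<subseteq> B" "set (b # BD) \<subseteq> B"
    "set BA \<inter> set BC = {}" "set BA \<inter> set BD = {}" "set BC \<inter> set BD = {}"
    by (rule tripod[OF E conn(2) ab(2) bc(1) bd(1)])
  obtain c CA CB CD where c: "path_list ?E (c # CA)" "path_list ?E (c # CB)" "path_list ?E (c # CD)"
    "last (c # CA) = ca" "last (c # CB) = cb" "last (c # CD) = cd"
    "set (c # CA) \<subseteq> C" "set (c # CB) \<subseteq> C" "set (c # CD) \<subseteq> C"
    "set CA \<inter> set CB = {}" "set CA \<inter> set CD = {}" "set CB \<inter> set CD = {}"
    by (rule tripod[OF E conn(3) ac(2) bc(2) cd(1)])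
  obtain d DA DB DC where d: "path_list ?E (d # DA)" "path_list ?E (d # DB)" "path_list ?E (d # DC)"
    "last (d # DA) = da" "last (d # DB) = db" "last (d # DC) = dc"
    "set (d # DA) \<subseteq> D" "set (d # DB) \<subseteq> D" "set (d # DC) \<subseteq> D"
    "set DA \<inter> set DB = {}" "set DA \<inter> set DC = {}" "set DB \<inter> set DC = {}"
    by (rule tripod[OF E conn(4) ad(2) bd(2) cd(2)])
  define link where "link x xs y ys = (x # xs) @ rev (y # ys)" for x y :: 'a and xs ys
  have link: "path_list ?E (link x xs y ys)" "arc_between (path_drawing \<gamma> (link x xs y ys)) (p x) (p y)"
    "x \<in> pverts \<Gamma>" "y \<in> pverts \<Gamma>"
    if "path_list ?E (x # xs)" "path_list ?E (y # ys)" "(last (x # xs), last (y # ys)) \<in> ?E"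
      "set (x # xs) \<subseteq> X" "set (y # ys) \<subseteq> Y" "X \<inter> Y = {}" for x xs y ys X Y
  proof -
    have "set (x # xs) \<inter> set (rev (y # ys)) = {}" using that(4-6) by (simp only: set_rev) blast
    moreover have "hd (rev (y # ys)) = last (y # ys)" by (rule hd_rev)
    ultimately show 1: "path_list ?E (link x xs y ys)"
      unfolding link_def path_list_append path_list_rev[OF E] using that(1-3) by simp
    show "arc_between (path_drawing \<gamma> (link x xs y ys)) (p x) (p y)"
      using arc_between_path_drawing[OF 1] by (simp add: link_def)
    have arcD: "u \<in> pverts \<Gamma>" "v \<in> pverts \<Gamma>" if "(u, v) \<in> ?E" for u v
      using that in_arcsD1 in_arcsD2 by blast+
    show "x \<in> pverts \<Gamma>" using that(1,3) by (cases xs) (auto simp: path_list_Cons dest: arcD)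
    show "y \<in> pverts \<Gamma>" using that(2,3) by (cases ys) (auto simp: path_list_Cons dest: arcD)
  qed
  have set_link: "set (link x xs y ys) = set (x # xs) \<union> set (y # ys)" for x xs y ys
    by (auto simp: link_def)
  then have set_link_commute: "set (link x xs y ys) = set (link y ys x xs)" for x xs y ys
    by blast
  have share: "set (link x xs y ys) \<inter> set (link x xs' z zs) = {x}"
    if "set (x # xs) \<subseteq> X" "set (x # xs') \<subseteq> X" "set xs \<inter> set xs' = {}" "x \<notin> set xs"
      "set (y # ys) \<subseteq> Y" "set (z # zs) \<subseteq> Z" "X \<inter> Y = {}" "X \<inter> Z = {}" "Y \<inter> Z = {}"
    for x xs y ys xs' z zs X Y Z
  proof -
    have "set (link x xs y ys) \<inter> set (link x xs' z zs) = set (x # xs) \<inter> set (x # xs')"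
      unfolding set_link using that(1,2,5-9) by blast
    also have "\<dots> = {x}" using that(3,4) by auto
    finally show ?thesis .
  qed
  have apart: "set (link x xs y ys) \<inter> set (link z zs w ws) = {}"
    if "set (x # xs) \<subseteq> X" "set (y # ys) \<subseteq> Y" "set (z # zs) \<subseteq> Z" "set (w # ws) \<subseteq> W"
      "X \<inter> Z = {}" "X \<inter> W = {}" "Y \<inter> Z = {}" "Y \<inter> W = {}"
    for x xs y ys z zs w ws X Y Z W
    unfolding set_link using that by blast
  have one: "path_drawing \<gamma> xs \<inter> path_drawing \<gamma> ys = {p v}"
    if "path_list ?E xs" "path_list ?E ys" "set xs \<inter> set ys = {v}"
      "p v \<in> path_drawing \<gamma> xs" "p v \<in> path_drawing \<gamma> ys" for xs ys v
    using path_drawing_Int[OF that(1,2), of v] that by auto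
  have none: "path_drawing \<gamma> xs \<inter> path_drawing \<gamma> ys = {}"
    if "path_list ?E xs" "path_list ?E ys" "set xs \<inter> set ys = {}" for xs ys
    using path_drawing_Int[OF that(1,2)] that by auto
  note LAB = link[OF a(1) b(1) _ a(7) b(7) disj(1), unfolded a b, OF ab(3)]
  note LAC = link[OF a(2) c(1) _ a(8) c(7) disj(2), unfolded a c, OF ac(3)]
  note LAD = link[OF a(3) d(1) _ a(9) d(7) disj(3), unfolded a d, OF ad(3)]
  note LBC = link[OF b(2) c(2) _ b(8) c(8) disj(4), unfolded b c, OF bc(3)]
  note LBD = link[OF b(3) d(2) _ b(9) d(8) disj(5), unfolded b d, OF bd(3)]
  note LCD = link[OF c(3) d(3) _ c(9) d(9) disj(6), unfolded c d, OF cd(3)]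
  note L = LAB(2) LAC(2) LAD(2) LBC(2) LBD(2) LCD(2)
  note ends = L[THEN arc_between_ends(1)] L[THEN arc_between_ends(2)]
  have da: "a \<notin> set AB" "a \<notin> set AC" "a \<notin> set AD" using a(1-3) by (auto simp: path_list_Cons)
  have db: "b \<notin> set BA" "b \<notin> set BC" "b \<notin> set BD" using b(1-3) by (auto simp: path_list_Cons)
  have dc: "c \<notin> set CA" "c \<notin> set CB" "c \<notin> set CD" using c(1-3) by (auto simp: path_list_Cons)
  have dd: "d \<notin> set DA" "d \<notin> set DB" "d \<notin> set DC" using d(1-3) by (auto simp: path_list_Cons)
  have "{a, b, c, d} \<subseteq> pverts \<Gamma>"
    using LAB(3) LBC(3) LCD(3,4) by blast
  then have outer': "{p a, p b, p c, p d} \<subseteq> closure (outside (drawing_image \<Gamma> p \<gamma>))"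
    using outer by (auto simp: frontier_def)
  show False
  proof (rule no_outer_plane_K4[OF L _ _ _ _ _ _ _ _ _ _ _ _ _ _ _ _ outer'])
    show "path_drawing \<gamma> (link a AB b BA) \<inter> path_drawing \<gamma> (link a AC c CA) = {p a}"
      by (rule one[OF LAB(1) LAC(1) _ ends(1,2)]) (rule share[OF a(7,8,10) da(1) b(7) c(7) disj(1,2,4)])
    show "path_drawing \<gamma> (link a AB b BA) \<inter> path_drawing \<gamma> (link a AD d DA) = {p a}"
      by (rule one[OF LAB(1) LAD(1) _ ends(1,3)]) (rule share[OF a(7,9,11) da(1) b(7) d(7) disj(1,3,5)])
    show "path_drawing \<gamma> (link a AC c CA) \<inter> path_drawing \<gamma> (link a AD d DA) = {p a}"
      by (rule one[OF LAC(1) LAD(1) _ ends(2,3)]) (rule share[OF a(8,9,12) da(2) c(7) d(7) disj(2,3,6)])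
    \<comment> \<open>\<open>share\<close> expects the common center as first vertex of both links,
      so from here on some links are read from their other end.\<close>
    show "path_drawing \<gamma> (link a AB b BA) \<inter> path_drawing \<gamma> (link b BC c CB) = {p b}"
      by (rule one[OF LAB(1) LBC(1) _ ends(7,4)], subst set_link_commute)
         (rule share[OF b(7,8,10) db(1) a(7) c(8) disj'(1) disj(4,2)])
    show "path_drawing \<gamma> (link a AB b BA) \<inter> path_drawing \<gamma> (link b BD d DB) = {p b}"
      by (rule one[OF LAB(1) LBD(1) _ ends(7,5)], subst set_link_commute)
         (rule share[OF b(7,9,11) db(1) a(7) d(8) disj'(1) disj(5,3)])
    show "path_drawing \<gamma> (link b BC c CB) \<inter> path_drawing \<gamma> (link b BD d DB) = {p b}"
      by (rule one[OF LBC(1) LBD(1) _ ends(4,5)]) (rule share[OF b(8,9,12) db(2) c(8) d(8) disj(4,5,6)])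
    show "path_drawing \<gamma> (link a AC c CA) \<inter> path_drawing \<gamma> (link b BC c CB) = {p c}"
      by (rule one[OF LAC(1) LBC(1) _ ends(8,10)], subst set_link_commute, subst (2) set_link_commute)
         (rule share[OF c(7,8,10) dc(1) a(8) b(8) disj'(2,4) disj(1)])
    show "path_drawing \<gamma> (link a AC c CA) \<inter> path_drawing \<gamma> (link c CD d DC) = {p c}"
      by (rule one[OF LAC(1) LCD(1) _ ends(8,6)], subst set_link_commute)
         (rule share[OF c(7,9,11) dc(1) a(8) d(9) disj'(2) disj(6,3)])
    show "path_drawing \<gamma> (link b BC c CB) \<inter> path_drawing \<gamma> (link c CD d DC) = {p c}"
      by (rule one[OF LBC(1) LCD(1) _ ends(10,6)], subst set_link_commute)
         (rule share[OF c(8,9,12) dc(2) b(8) d(9) disj'(4) disj(6,5)])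
    show "path_drawing \<gamma> (link a AD d DA) \<inter> path_drawing \<gamma> (link b BD d DB) = {p d}"
      by (rule one[OF LAD(1) LBD(1) _ ends(9,11)], subst set_link_commute, subst (2) set_link_commute)
         (rule share[OF d(7,8,10) dd(1) a(9) b(9) disj'(3,5) disj(1)])
    show "path_drawing \<gamma> (link a AD d DA) \<inter> path_drawing \<gamma> (link c CD d DC) = {p d}"
      by (rule one[OF LAD(1) LCD(1) _ ends(9,12)], subst set_link_commute, subst (2) set_link_commute)
         (rule share[OF d(7,9,11) dd(1) a(9) c(9) disj'(3,6) disj(2)])
    show "path_drawing \<gamma> (link b BD d DB) \<inter> path_drawing \<gamma> (link c CD d DC) = {p d}"
      by (rule one[OF LBD(1) LCD(1) _ ends(11,12)], subst set_link_commute, subst (2) set_link_commute)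
         (rule share[OF d(8,9,12) dd(2) b(9) c(9) disj'(5,6) disj(4)])
    show "path_drawing \<gamma> (link a AB b BA) \<inter> path_drawing \<gamma> (link c CD d DC) = {}"
      by (rule none[OF LAB(1) LCD(1)]) (rule apart[OF a(7) b(7) c(9) d(9) disj(2,3,4,5)])
    show "path_drawing \<gamma> (link a AC c CA) \<inter> path_drawing \<gamma> (link b BD d DB) = {}"
      by (rule none[OF LAC(1) LBD(1)]) (rule apart[OF a(8) c(7) b(9) d(8) disj(1,3) disj'(4) disj(6)])
    show "path_drawing \<gamma> (link a AD d DA) \<inter> path_drawing \<gamma> (link b BC c CB) = {}"
      by (rule none[OF LAD(1) LBC(1)]) (rule apart[OF a(9) d(7) b(8) c(8) disj(1,2) disj'(5,6)])
    show "path_drawing \<gamma> (link a AB b BA) \<union> path_drawing \<gamma> (link a AC c CA) \<union>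
        path_drawing \<gamma> (link a AD d DA) \<union> path_drawing \<gamma> (link b BC c CB) \<union>
        path_drawing \<gamma> (link b BD d DB) \<union> path_drawing \<gamma> (link c CD d DC) \<subseteq> drawing_image \<Gamma> p \<gamma>"
      using LAB(1) LAC(1) LAD(1) LBC(1) LBD(1) LCD(1) by (simp add: path_drawing_subset)
  qed
qed

end

section \<open>Invariant colorings of induced minors\<close>

text \<open>For the family of singletons these correspond to the proper colorings of \<Gamma>/g, by
  \<open>card_proper_colorings_quotient\<close>. General families are what the induction passes
  through.\<close>

definition invariant_colorings ::
    "('a \<times> 'a) set \<Rightarrow> ('a \<Rightarrow> 'a) \<Rightarrow> 'a set set \<Rightarrow> nat \<Rightarrow> ('a set \<Rightarrow> nat) set" where
  "invariant_colorings E g \<B> k = {c \<in> \<B> \<rightarrow>\<^sub>E {..<k}. (\<forall>B\<in>\<B>. c (g ` B) = c B) \<and>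
     (\<forall>A\<in>\<B>. \<forall>B\<in>\<B>. branch_adj E A B \<longrightarrow> c A \<noteq> c B)}"

lemma invariant_coloringsI:
  assumes "c \<in> \<B> \<rightarrow>\<^sub>E {..<k}" "\<And>A. A \<in> \<B> \<Longrightarrow> c (g ` A) = c A"
    "\<And>A B. A \<in> \<B> \<Longrightarrow> B \<in> \<B> \<Longrightarrow> branch_adj E A B \<Longrightarrow> c A \<noteq> c B"
  shows "c \<in> invariant_colorings E g \<B> k"
  using assms unfolding invariant_colorings_def by simp

lemma invariant_coloringsD:
  assumes "c \<in> invariant_colorings E g \<B> k"
  shows "c \<in> \<B> \<rightarrow>\<^sub>E {..<k}" "\<And>A. A \<in> \<B> \<Longrightarrow> c (g ` A) = c A"
    "\<And>A B. A \<in> \<B> \<Longrightarrow> B \<in> \<B> \<Longrightarrow> branch_adj E A B \<Longrightarrow> c A \<noteq> c B"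
  using assms unfolding invariant_colorings_def by simp_all

lemma finite_invariant_colorings: "finite \<B> \<Longrightarrow> finite (invariant_colorings E g \<B> k)"
  unfolding invariant_colorings_def by (rule finite_subset[OF _ finite_PiE[of \<B> "\<lambda>_. {..<k}"]]) auto

section \<open>The action of an automorphism on induced minors\<close>

locale graph_automorphism =
  fixes V :: "'a set" and E :: "('a \<times> 'a) set" and g :: "'a \<Rightarrow> 'a"
  assumes finite_V: "finite V" and E_V: "E \<subseteq> V \<times> V" and sym_E: "sym E"
    and inj_g: "inj_on g V" and g_V: "g ` V \<subseteq> V"
    and aut: "u \<in> V \<Longrightarrow> v \<in> V \<Longrightarrow> (g u, g v) \<in> E \<longleftrightarrow> (u, v) \<in> E"
begin

lemma branch_adj_image:
  assumes "A \<subseteq> V" "B \<subseteq> V"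
  shows "branch_adj E (g ` A) (g ` B) \<longleftrightarrow> branch_adj E A B"
proof -
  have "g ` A = g ` B \<longleftrightarrow> A = B" using inj_on_image_eq_iff[OF inj_g assms] .
  moreover have "set_adj E (g ` A) (g ` B) \<longleftrightarrow> set_adj E A B"
    using aut assms unfolding set_adj_def by (simp add: subset_iff)
  ultimately show ?thesis unfolding branch_adj_def by blast
qed

definition invariant_family :: "'a set set \<Rightarrow> bool" where
  "invariant_family \<B> \<longleftrightarrow> branch_family E \<B> \<and> \<B> \<subseteq> Pow V \<and> (`) g ` \<B> = \<B>"

definition neighbors :: "'a set set \<Rightarrow> 'a set \<Rightarrow> 'a set set" where
  "neighbors \<B> X = {A \<in> \<B>. branch_adj E X A}"

lemma neighbors_image:
  assumes "invariant_family \<B>" "X \<in> \<B>"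
  shows "neighbors \<B> (g ` X) = (`) g ` neighbors \<B> X"
proof -
  have \<B>: "\<B> \<subseteq> Pow V" "(`) g ` \<B> = \<B>" using assms(1) unfolding invariant_family_def by blast+
  have "neighbors \<B> (g ` X) = {A \<in> (`) g ` \<B>. branch_adj E (g ` X) A}"
    unfolding neighbors_def \<B>(2) ..
  also have "\<dots> = (`) g ` {A \<in> \<B>. branch_adj E (g ` X) (g ` A)}" by blast
  also have "{A \<in> \<B>. branch_adj E (g ` X) (g ` A)} = neighbors \<B> X"
    unfolding neighbors_def using \<B>(1) assms(2) branch_adj_image by blast
  finally show ?thesis .
qed

text \<open>The least set of members of \<open>\<B>\<close> that contains \<open>B\<close> and is closed under \<open>g\<close> in both directions.\<close>

definition branch_orbit :: "'a set set \<Rightarrow> 'a set \<Rightarrow> 'a set set" where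
  "branch_orbit \<B> B = {X \<in> \<B>. \<forall>P. P B \<and> (\<forall>Y\<in>\<B>. P (g ` Y) \<longleftrightarrow> P Y) \<longrightarrow> P X}"

lemma branch_orbit_induct:
  assumes "X \<in> branch_orbit \<B> B" "P B" "\<And>Y. Y \<in> \<B> \<Longrightarrow> P (g ` Y) \<longleftrightarrow> P Y"
  shows "P X"
  using assms unfolding branch_orbit_def by blast

lemma branch_orbit_self: "B \<in> \<B> \<Longrightarrow> B \<in> branch_orbit \<B> B"
  unfolding branch_orbit_def by blast

lemma branch_orbit_subset: "branch_orbit \<B> B \<subseteq> \<B>"
  unfolding branch_orbit_def by blast

lemma branch_orbit_image_iff:
  assumes "invariant_family \<B>" "X \<in> \<B>"
  shows "g ` X \<in> branch_orbit \<B> B \<longleftrightarrow> X \<in> branch_orbit \<B> B"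
proof -
  have "g ` X \<in> \<B>" using assms unfolding invariant_family_def by blast
  then show ?thesis using assms(2) unfolding branch_orbit_def by auto
qed

lemma invariant_family_minus_orbit:
  assumes "invariant_family \<B>"
  shows "invariant_family (\<B> - branch_orbit \<B> B)"
proof -
  let ?O = "branch_orbit \<B> B"
  have \<B>: "(`) g ` \<B> = \<B>" using assms unfolding invariant_family_def by blast
  have "(`) g ` (\<B> - ?O) = \<B> - ?O"
  proof
    show "(`) g ` (\<B> - ?O) \<subseteq> \<B> - ?O"
      using \<B> branch_orbit_image_iff[OF assms] by auto
    show "\<B> - ?O \<subseteq> (`) g ` (\<B> - ?O)"
    proof
      fix Y assume Y: "Y \<in> \<B> - ?O"
      then obtain X where "X \<in> \<B>" "Y = g ` X" using \<B> by blast
      then show "Y \<in> (`) g ` (\<B> - ?O)" using Y branch_orbit_image_iff[OF assms] by blast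
    qed
  qed
  moreover have "branch_family E (\<B> - ?O)"
    using assms unfolding invariant_family_def branch_family_def by (auto intro: pairwise_subset)
  ultimately show ?thesis using assms unfolding invariant_family_def by blast
qed

text \<open>An invariant coloring is constant on the orbit; in the quotient the adjacent pair is a
  loop.\<close>

lemma colorings_empty_of_adjacent_orbit:
  assumes "invariant_family \<B>"
    and "X \<in> branch_orbit \<B> B" "Y \<in> branch_orbit \<B> B" "branch_adj E X Y"
  shows "invariant_colorings E g \<B> k = {}"
proof (rule ccontr)
  assume "invariant_colorings E g \<B> k \<noteq> {}"
  then obtain c where "c \<in> invariant_colorings E g \<B> k" by blast
  note c = invariant_coloringsD(2)[OF this] and pr = invariant_coloringsD(3)[OF this]
  have "c Z = c B" if "Z \<in> branch_orbit \<B> B" for Z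
    using that by (rule branch_orbit_induct) (simp_all add: c)
  then show False using pr[of X Y] assms(2-4) branch_orbit_subset by fastforce
qed

end

section \<open>Deleting an independent orbit and contracting its edges\<close>

locale independent_orbit = graph_automorphism +
  fixes \<B> :: "'a set set" and B :: "'a set"
  assumes family: "invariant_family \<B>" and B: "B \<in> \<B>"
    and independent: "X \<in> branch_orbit \<B> B \<Longrightarrow> Y \<in> branch_orbit \<B> B \<Longrightarrow> \<not> branch_adj E X Y"
begin

abbreviation \<O> :: "'a set set" where "\<O> \<equiv> branch_orbit \<B> B"

lemma \<B>_V: "X \<in> \<B> \<Longrightarrow> X \<subseteq> V"
  and \<B>_image: "(`) g ` \<B> = \<B>"
  and \<B>_branch: "branch_family E \<B>"
  and \<B>_finite: "finite \<B>"
  using family unfolding invariant_family_def branch_family_def by auto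

lemma \<O>_sub: "\<O> \<subseteq> \<B>"
  by (rule branch_orbit_subset)

lemma \<O>_image_iff: "X \<in> \<B> \<Longrightarrow> g ` X \<in> \<O> \<longleftrightarrow> X \<in> \<O>"
  by (rule branch_orbit_image_iff[OF family])

lemma branch_adj_sym: "branch_adj E X Y \<Longrightarrow> branch_adj E Y X"
  using set_adj_sym[OF sym_E] unfolding branch_adj_def by blast

lemma neighbors_orbit: "X \<in> \<O> \<Longrightarrow> neighbors \<B> X \<subseteq> \<B> - \<O>"
  using independent unfolding neighbors_def by blast

lemma neighbor_colors:
  assumes c: "\<And>A. A \<in> \<B> - \<O> \<Longrightarrow> c (g ` A) = c A" and X: "X \<in> \<O>"
  shows "c ` neighbors \<B> X = c ` neighbors \<B> B"
proof -
  have "X \<in> \<O> \<longrightarrow> c ` neighbors \<B> X = c ` neighbors \<B> B"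
  proof (rule branch_orbit_induct[OF X])
    fix Y assume Y: "Y \<in> \<B>"
    have "c ` neighbors \<B> (g ` Y) = c ` neighbors \<B> Y" if "Y \<in> \<O>"
      unfolding neighbors_image[OF family Y] image_image
      using c neighbors_orbit[OF that] by (intro image_cong refl) blast
    then show "(g ` Y \<in> \<O> \<longrightarrow> c ` neighbors \<B> (g ` Y) = c ` neighbors \<B> B) \<longleftrightarrow>
        (Y \<in> \<O> \<longrightarrow> c ` neighbors \<B> Y = c ` neighbors \<B> B)"
      using \<O>_image_iff[OF Y] by auto
  qed simp
  then show ?thesis using X by blast
qed

text \<open>The orbit carries a single color. Independence leaves only the neighbors outside as
  constraints, and by \<open>neighbor_colors\<close> those of \<open>B\<close> stand for all of
  them.\<close>

lemma card_colorings_delete_orbit: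
  "card (invariant_colorings E g \<B> k) =
     (\<Sum>c\<in>invariant_colorings E g (\<B> - \<O>) k. k - card (c ` neighbors \<B> B))"
proof -
  let ?C = "invariant_colorings E g \<B> k" and ?C' = "invariant_colorings E g (\<B> - \<O>) k"
  let ?S = "Sigma ?C' (\<lambda>c. {..<k} - c ` neighbors \<B> B)"
  have BO: "B \<in> \<O>" by (rule branch_orbit_self[OF B])
  have "bij_betw (\<lambda>c. (restrict c (\<B> - \<O>), c B)) ?C ?S"
  proof (rule bij_betw_byWitness[where f' = "\<lambda>(c, t) X. if X \<in> \<O> then t else c X"])
    have const: "c X = c B" if "c \<in> ?C" "X \<in> \<O>" for c X
      using that(2) by (rule branch_orbit_induct) (use that(1) in \<open>auto simp: invariant_colorings_def\<close>)
    show "\<forall>c\<in>?C. (case (restrict c (\<B> - \<O>), c B) of (c, t) \<Rightarrow> \<lambda>X. if X \<in> \<O> then t else c X) = c"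
    proof
      fix c assume c: "c \<in> ?C"
      then have "c \<in> \<B> \<rightarrow>\<^sub>E {..<k}" unfolding invariant_colorings_def by blast
      then have "c X = undefined" if "X \<notin> \<B>" for X using that by (rule PiE_arb)
      then have "(if X \<in> \<O> then c B else restrict c (\<B> - \<O>) X) = c X" for X
        using const[OF c, of X] by (cases "X \<in> \<B>") auto
      then show "(case (restrict c (\<B> - \<O>), c B) of (c, t) \<Rightarrow> \<lambda>X. if X \<in> \<O> then t else c X) = c"
        by simp
    qed
    show "\<forall>ct\<in>?S. (restrict (case ct of (c, t) \<Rightarrow> \<lambda>X. if X \<in> \<O> then t else c X) (\<B> - \<O>),
        (case ct of (c, t) \<Rightarrow> \<lambda>X. if X \<in> \<O> then t else c X) B) = ct"
    proof
      fix ct assume "ct \<in> ?S"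
      then obtain c t where ct: "ct = (c, t)" "c \<in> ?C'" by blast
      have "c X = undefined" if "X \<notin> \<B> - \<O>" for X
        using that by (rule PiE_arb[OF invariant_coloringsD(1)[OF ct(2)]])
      then have "restrict (\<lambda>X. if X \<in> \<O> then t else c X) (\<B> - \<O>) = c"
        by (intro ext) (simp add: restrict_def)
      then show "(restrict (case ct of (c, t) \<Rightarrow> \<lambda>X. if X \<in> \<O> then t else c X) (\<B> - \<O>),
        (case ct of (c, t) \<Rightarrow> \<lambda>X. if X \<in> \<O> then t else c X) B) = ct"
        using ct(1) BO by simp
    qed
    show "(\<lambda>c. (restrict c (\<B> - \<O>), c B)) ` ?C \<subseteq> ?S"
    proof (rule image_subsetI)
      fix c assume c: "c \<in> ?C"
      note c1 = invariant_coloringsD(1)[OF c] and c2 = invariant_coloringsD(2)[OF c]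
        and c3 = invariant_coloringsD(3)[OF c]
      have img: "g ` A \<in> \<B> - \<O>" if "A \<in> \<B> - \<O>" for A
        using that \<O>_image_iff[of A] \<B>_image by blast
      have "restrict c (\<B> - \<O>) \<in> ?C'"
      proof (rule invariant_coloringsI)
        show "restrict c (\<B> - \<O>) \<in> \<B> - \<O> \<rightarrow>\<^sub>E {..<k}" using c1 by (auto simp: PiE_iff)
        show "restrict c (\<B> - \<O>) (g ` A) = restrict c (\<B> - \<O>) A" if "A \<in> \<B> - \<O>" for A
          using c2[of A] img[OF that] that by simp
      qed (use c3 in auto)
      moreover have "c B \<in> {..<k} - restrict c (\<B> - \<O>) ` neighbors \<B> B"
      proof -
        have "restrict c (\<B> - \<O>) ` neighbors \<B> B = c ` neighbors \<B> B"
          using neighbors_orbit[OF BO] by (intro image_cong refl) auto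
        moreover have "c B \<notin> c ` neighbors \<B> B"
          using c3[OF B] unfolding neighbors_def by auto
        ultimately show ?thesis using c1 B by auto
      qed
      ultimately show "(restrict c (\<B> - \<O>), c B) \<in> ?S" by blast
    qed
    show "(\<lambda>(c, t) X. if X \<in> \<O> then t else c X) ` ?S \<subseteq> ?C"
    proof (rule image_subsetI)
      fix ct assume "ct \<in> ?S"
      then obtain c t where ct: "ct = (c, t)" and c: "c \<in> ?C'" and t: "t < k" "t \<notin> c ` neighbors \<B> B"
        by blast
      note c1 = invariant_coloringsD(1)[OF c] and c2 = invariant_coloringsD(2)[OF c]
        and c3 = invariant_coloringsD(3)[OF c]
      define d where "d X = (if X \<in> \<O> then t else c X)" for X
      have d1: "d \<in> \<B> \<rightarrow>\<^sub>E {..<k}"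
        using c1 t(1) \<O>_sub unfolding d_def by (auto simp: PiE_iff extensional_def)
      have d2: "d (g ` A) = d A" if "A \<in> \<B>" for A
        using c2 that \<O>_image_iff[OF that] unfolding d_def by auto
      have mixed: "c Y \<noteq> t" if "X \<in> \<O>" "Y \<in> \<B> - \<O>" "branch_adj E X Y" for X Y
      proof -
        have "c Y \<in> c ` neighbors \<B> X" using that unfolding neighbors_def by blast
        then show ?thesis using neighbor_colors[of c X, OF c2 that(1)] t(2) by auto
      qed
      have d3: "d X \<noteq> d Y" if "X \<in> \<B>" "Y \<in> \<B>" "branch_adj E X Y" for X Y
        using that independent[of X Y] mixed[of X Y] mixed[of Y X] c3[of X Y] branch_adj_sym[OF that(3)]
        unfolding d_def by auto
      have "d \<in> ?C" by (rule invariant_coloringsI[OF d1 d2 d3])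
      then show "(case ct of (c, t) \<Rightarrow> \<lambda>X. if X \<in> \<O> then t else c X) \<in> ?C"
        unfolding ct d_def by simp
    qed
  qed
  then have "card ?C = card ?S" by (rule bij_betw_same_card)
  also have "\<dots> = (\<Sum>c\<in>?C'. card ({..<k} - c ` neighbors \<B> B))"
    by (rule card_SigmaI) (use finite_invariant_colorings[of "\<B> - \<O>"] \<B>_finite in auto)
  also have "\<dots> = (\<Sum>c\<in>?C'. k - card (c ` neighbors \<B> B))"
  proof (rule sum.cong[OF refl])
    fix c assume "c \<in> ?C'"
    then have "c ` neighbors \<B> B \<subseteq> {..<k}"
      using neighbors_orbit[OF BO] invariant_coloringsD(1)[of c] by (auto simp: PiE_iff)
    then show "card ({..<k} - c ` neighbors \<B> B) = k - card (c ` neighbors \<B> B)"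
      by (simp add: card_Diff_subset finite_subset)
  qed
  finally show ?thesis .
qed

text \<open>\<open>merged X\<close> is the branch set containing \<open>X\<close> after contraction of all edges at the orbit \<open>\<O>\<close>.\<close>

definition star :: "('a set \<times> 'a set) set" where
  "star = {(X, Y). X \<in> \<B> \<and> Y \<in> \<B> \<and> branch_adj E X Y \<and> (X \<in> \<O> \<or> Y \<in> \<O>)}"

definition merged :: "'a set \<Rightarrow> 'a set" where
  "merged X = \<Union>(star\<^sup>* `` {X})"

lemma sym_star: "sym (star\<^sup>*)"
  by (rule sym_rtrancl) (auto simp: sym_def star_def branch_adj_sym)

lemma star_\<B>: "(X, Y) \<in> star\<^sup>* \<Longrightarrow> X \<in> \<B> \<Longrightarrow> Y \<in> \<B>"
  by (induction rule: rtrancl_induct) (auto simp: star_def)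

lemma merge_cong: "(X, Y) \<in> star\<^sup>* \<Longrightarrow> merged X = merged Y"
  unfolding merged_def using sym_star by (intro arg_cong[where f = Union]) (auto dest: symD intro: rtrancl_trans)

lemma mem_merge_unique:
  assumes "X \<in> \<B>" "Y \<in> \<B>" "x \<in> merged X" "x \<in> Y"
  shows "(X, Y) \<in> star\<^sup>*"
proof -
  obtain Z where Z: "(X, Z) \<in> star\<^sup>*" "x \<in> Z" using assms(3) unfolding merged_def by blast
  then have "Z \<in> \<B>" using star_\<B> assms(1) by blast
  then have "Z = Y" using \<B>_branch assms(2,4) Z(2) unfolding branch_family_def disjoint_def by blast
  then show ?thesis using Z by blast
qed

lemma subset_merge: "X \<subseteq> merged X"
  unfolding merged_def by blast

lemma merge_eq_iff:
  assumes "X \<in> \<B>" "Y \<in> \<B>"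
  shows "merged X = merged Y \<longleftrightarrow> (X, Y) \<in> star\<^sup>*"
proof
  assume "merged X = merged Y"
  moreover obtain y where "y \<in> Y"
    using assms(2) \<B>_branch unfolding branch_family_def by (metis ex_in_conv)
  ultimately show "(X, Y) \<in> star\<^sup>*"
    using mem_merge_unique[OF assms] subset_merge by blast
qed (rule merge_cong)

lemma connected_in_merge:
  assumes X: "X \<in> \<B>"
  shows "connected_in E (merged X)"
  unfolding merged_def
proof (rule connected_in_Union)
  let ?A = "star\<^sup>* `` {X}"
  show "connected_in E Y \<and> Y \<noteq> {}" if "Y \<in> ?A" for Y
    using that star_\<B> X \<B>_branch unfolding branch_family_def by blast
  have "(Y, Z) \<in> ({(X, Y). branch_adj E X Y} \<inter> ?A \<times> ?A)\<^sup>*"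
    if Y: "(X, Y) \<in> star\<^sup>*" and YZ: "(Y, Z) \<in> star\<^sup>*" for Y Z
    using YZ
  proof (induction rule: rtrancl_induct)
    case (step W Z)
    then have "(X, W) \<in> star\<^sup>*" "(X, Z) \<in> star\<^sup>*" "branch_adj E W Z"
      using Y by (auto simp: star_def intro: rtrancl_trans)
    then show ?case using step.IH by (auto intro: rtrancl_into_rtrancl)
  qed simp
  moreover have "(Y, Z) \<in> star\<^sup>*" if "(X, Y) \<in> star\<^sup>*" "(X, Z) \<in> star\<^sup>*" for Y Z
    using that sym_star by (meson rtrancl_trans symE)
  ultimately show "connected_in {(X, Y). branch_adj E X Y} ?A"
    unfolding connected_in_def by blast
qed

lemma star_image_iff:
  assumes "X \<in> \<B>" "Y \<in> \<B>"
  shows "(g ` X, g ` Y) \<in> star \<longleftrightarrow> (X, Y) \<in> star"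
proof -
  have "g ` X \<in> \<B>" "g ` Y \<in> \<B>" using assms \<B>_image by blast+
  then show ?thesis
    using assms \<O>_image_iff branch_adj_image \<B>_V unfolding star_def by simp
qed

lemma star_rtrancl_image:
  assumes X: "X \<in> \<B>"
  shows "star\<^sup>* `` {g ` X} = (`) g ` (star\<^sup>* `` {X})"
proof
  show "star\<^sup>* `` {g ` X} \<subseteq> (`) g ` (star\<^sup>* `` {X})"
  proof
    fix Z assume "Z \<in> star\<^sup>* `` {g ` X}"
    then have "(g ` X, Z) \<in> star\<^sup>*" by blast
    then show "Z \<in> (`) g ` (star\<^sup>* `` {X})"
    proof (induction rule: rtrancl_induct)
      case (step W Z)
      then obtain Y where Y: "(X, Y) \<in> star\<^sup>*" "W = g ` Y" by blast
      have "Z \<in> \<B>" using step(2) unfolding star_def by blast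
      then obtain Y' where Y': "Y' \<in> \<B>" "Z = g ` Y'" using \<B>_image by blast
      then have "(Y, Y') \<in> star" using star_image_iff[of Y Y'] star_\<B>[OF Y(1) X] Y(2) step(2) by simp
      then show ?case using Y Y' by (auto intro: rtrancl_into_rtrancl)
    qed blast
  qed
  have "(g ` X, g ` Y) \<in> star\<^sup>*" if "(X, Y) \<in> star\<^sup>*" for Y
    using that
  proof (induction rule: rtrancl_induct)
    case (step Y Z)
    then have "(g ` Y, g ` Z) \<in> star" using star_image_iff unfolding star_def by blast
    then show ?case using step by (blast intro: rtrancl_into_rtrancl)
  qed simp
  then show "(`) g ` (star\<^sup>* `` {X}) \<subseteq> star\<^sup>* `` {g ` X}" by blast
qed

lemma merge_image: "X \<in> \<B> \<Longrightarrow> merged (g ` X) = g ` merged X"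
  unfolding merged_def star_rtrancl_image by blast

text \<open>The reason for contracting at the whole orbit: contracting at \<open>B\<close> alone
  would in general destroy the invariance under \<open>g\<close>.\<close>

lemma invariant_family_merge: "invariant_family (merged ` \<B>)"
proof -
  have "disjoint (merged ` \<B>)"
  proof (rule disjointI)
    fix M M' assume M: "M \<in> merged ` \<B>" "M' \<in> merged ` \<B>" "M \<noteq> M'"
    then obtain X Y where XY: "X \<in> \<B>" "Y \<in> \<B>" "M = merged X" "M' = merged Y" by blast
    show "M \<inter> M' = {}"
    proof (rule ccontr)
      assume "M \<inter> M' \<noteq> {}"
      then obtain x Z where xZ: "x \<in> M" "x \<in> Z" "(Y, Z) \<in> star\<^sup>*" unfolding XY merged_def by blast
      then have "(X, Z) \<in> star\<^sup>*" using mem_merge_unique XY star_\<B> by blast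
      then show False using M(3) XY xZ(3) merge_cong by simp
    qed
  qed
  moreover have "{} \<notin> merged ` \<B>"
  proof
    assume "{} \<in> merged ` \<B>"
    then obtain X where "X \<in> \<B>" "merged X = {}" by force
    then show False using subset_merge[of X] \<B>_branch unfolding branch_family_def by simp
  qed
  moreover have "merged ` \<B> \<subseteq> Pow V"
    using \<B>_V star_\<B> unfolding merged_def by blast
  moreover have "(`) g ` merged ` \<B> = merged ` \<B>"
  proof -
    have "(`) g ` merged ` \<B> = merged ` (`) g ` \<B>"
      unfolding image_image by (intro image_cong refl) (simp add: merge_image)
    then show ?thesis unfolding \<B>_image .
  qed
  ultimately show ?thesis
    using connected_in_merge \<B>_finite unfolding invariant_family_def branch_family_def by blast
qed

context
  fixes A1 A2 :: "'a set"
  assumes two_neighbors: "neighbors \<B> B = {A1, A2}"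
begin

lemma neighbor_in_star: "A \<in> {A1, A2} \<Longrightarrow> (B, A) \<in> star \<and> A \<in> \<B> - \<O>"
  using two_neighbors neighbors_orbit[OF branch_orbit_self[OF B]] branch_orbit_self[OF B] B
  unfolding star_def neighbors_def by blast

lemma card_merge_less: "card (merged ` \<B>) < card \<B>"
proof -
  have "merged B = merged A1" using neighbor_in_star merge_cong by blast
  moreover have "B \<noteq> A1" "A1 \<in> \<B>" using neighbor_in_star[of A1] branch_orbit_self[OF B] by auto
  ultimately have "\<not> inj_on merged \<B>" using B by (meson inj_onD)
  then show ?thesis
    using \<B>_finite card_image_le[of \<B> merged] eq_card_imp_inj_on[of \<B> merged] by linarith
qed

text \<open>Colors the orbit like its neighbors. This is not proper on \<open>\<B>\<close>, but it
  is constant on every merged set and so descends to the contraction.\<close>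

definition orbit_extend :: "('a set \<Rightarrow> nat) \<Rightarrow> 'a set \<Rightarrow> nat" where
  "orbit_extend c X = (if X \<in> \<O> then c A1 else c X)"

text \<open>Each pair in \<open>star\<close> has an end in the orbit, and the neighbors of any orbit
  member show no color but \<open>c A1\<close>, by \<open>neighbor_colors\<close>.\<close>

lemma orbit_extend_star:
  assumes c: "\<And>A. A \<in> \<B> - \<O> \<Longrightarrow> c (g ` A) = c A" and "c A1 = c A2" and XY: "(X, Y) \<in> star\<^sup>*"
  shows "orbit_extend c X = orbit_extend c Y"
  using XY
proof (induction rule: rtrancl_induct)
  case (step Y Z)
  have half: "orbit_extend c X = orbit_extend c Y" if "X \<in> \<O>" "Y \<in> \<B>" "branch_adj E X Y" for X Y
  proof -
    have "c Y \<in> c ` neighbors \<B> X" using that unfolding neighbors_def by blast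
    then have "c Y = c A1" using neighbor_colors[of c X, OF c that(1)] two_neighbors assms(2) by auto
    moreover have "Y \<notin> \<O>" using independent that by blast
    ultimately show ?thesis using that unfolding orbit_extend_def by simp
  qed
  have "orbit_extend c Y = orbit_extend c Z"
    using step(2) half[of Y Z] half[of Z Y] branch_adj_sym[of Y Z] unfolding star_def by auto
  then show ?case using step.IH by simp
qed simp

text \<open>Pulling a coloring back along \<open>merged\<close> gives \<open>A1\<close> and
  \<open>A2\<close> the same color, as both are merged with \<open>B\<close>. Conversely
  \<open>orbit_extend\<close> descends to the merged sets.\<close>

lemma card_colorings_contract:
  assumes no_loop: "\<And>X Y. X \<in> \<B> - \<O> \<Longrightarrow> Y \<in> \<B> - \<O> \<Longrightarrow> branch_adj E X Y \<Longrightarrow> merged X \<noteq> merged Y"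
  shows "card {c \<in> invariant_colorings E g (\<B> - \<O>) k. c A1 = c A2} =
    card (invariant_colorings E g (merged ` \<B>) k)"
proof -
  let ?D = "{c \<in> invariant_colorings E g (\<B> - \<O>) k. c A1 = c A2}"
  let ?M = "invariant_colorings E g (merged ` \<B>) k"
  let ?f = "\<lambda>c. restrict (c \<circ> merged) (\<B> - \<O>)"
  have img: "g ` A \<in> \<B> - \<O>" if "A \<in> \<B> - \<O>" for A
    using that \<O>_image_iff[of A] \<B>_image by blast
  have rep: "\<exists>Y\<in>\<B> - \<O>. merged Y = merged X" if "X \<in> \<B>" for X
  proof (cases "X \<in> \<O>")
    case True
    \<comment> \<open>With a constant coloring, \<open>neighbor_colors\<close> says that
      \<open>X\<close> has a neighbor because \<open>B\<close> has one.\<close>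
    have "(\<lambda>_. 0::nat) ` neighbors \<B> X = (\<lambda>_. 0) ` neighbors \<B> B"
      by (rule neighbor_colors[OF _ True]) simp
    then obtain Y where Y: "Y \<in> neighbors \<B> X" using two_neighbors by auto
    then have "(X, Y) \<in> star" using True that unfolding star_def neighbors_def by blast
    then show ?thesis using merge_cong[of X Y] Y neighbors_orbit[OF True] by auto
  qed (use that in blast)
  have "inj_on ?f ?M"
  proof (rule inj_onI)
    fix c d assume cd: "c \<in> ?M" "d \<in> ?M" "?f c = ?f d"
    have ext: "c \<in> extensional (merged ` \<B>)" "d \<in> extensional (merged ` \<B>)"
      using cd(1,2) unfolding invariant_colorings_def by (auto simp: PiE_iff)
    show "c = d"
    proof (rule extensionalityI[OF ext])
      fix M assume "M \<in> merged ` \<B>"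
      then obtain Y where Y: "Y \<in> \<B> - \<O>" "M = merged Y" using rep by (metis imageE)
      then show "c M = d M" using fun_cong[OF cd(3), of Y] by simp
    qed
  qed
  moreover have "?f ` ?M = ?D"
  proof
    show "?f ` ?M \<subseteq> ?D"
    proof (rule image_subsetI)
      fix c assume c: "c \<in> ?M"
      note c1 = invariant_coloringsD(1)[OF c] and c2 = invariant_coloringsD(2)[OF c]
        and c3 = invariant_coloringsD(3)[OF c]
      have 1: "?f c \<in> \<B> - \<O> \<rightarrow>\<^sub>E {..<k}" using c1 by (auto simp: PiE_iff)
      have 2: "?f c (g ` A) = ?f c A" if "A \<in> \<B> - \<O>" for A
        using c2[of "merged A"] that img[OF that] merge_image[of A] by auto
      have 3: "?f c X \<noteq> ?f c Y" if "X \<in> \<B> - \<O>" "Y \<in> \<B> - \<O>" "branch_adj E X Y" for X Y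
      proof -
        have "branch_adj E (merged X) (merged Y)"
          using no_loop[OF that] that(3) subset_merge unfolding branch_adj_def set_adj_def by blast
        then show ?thesis using that c3[of "merged X" "merged Y"] by simp
      qed
      have "(A1, A2) \<in> star\<^sup>*"
        using neighbor_in_star[of A1] neighbor_in_star[of A2] sym_star by (meson insertCI r_into_rtrancl rtrancl_trans symE)
      then have "merged A1 = merged A2" by (rule merge_cong)
      then have 4: "?f c A1 = ?f c A2" using neighbor_in_star by simp
      have "?f c \<in> invariant_colorings E g (\<B> - \<O>) k" by (rule invariant_coloringsI[OF 1 2 3])
      then show "?f c \<in> ?D" using 4 by blast
    qed
    show "?D \<subseteq> ?f ` ?M"
    proof
      fix c assume "c \<in> ?D"
      then have c: "c \<in> invariant_colorings E g (\<B> - \<O>) k" and c4: "c A1 = c A2" by blast+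
      note c1 = invariant_coloringsD(1)[OF c] and c2 = invariant_coloringsD(2)[OF c]
        and c3 = invariant_coloringsD(3)[OF c]
      define d where "d = restrict (\<lambda>M. orbit_extend c (inv_into \<B> merged M)) (merged ` \<B>)"
      have d: "d (merged X) = orbit_extend c X" if "X \<in> \<B>" for X
      proof -
        let ?Y = "inv_into \<B> merged (merged X)"
        have "?Y \<in> \<B>" "merged ?Y = merged X"
          using that by (auto intro: inv_into_into simp: f_inv_into_f)
        then have "(?Y, X) \<in> star\<^sup>*" using merge_eq_iff that by blast
        then show ?thesis using orbit_extend_star[of c, OF c2 c4] that unfolding d_def by simp
      qed
      have d1: "d \<in> merged ` \<B> \<rightarrow>\<^sub>E {..<k}"
      proof -
        have "orbit_extend c X < k" if "X \<in> \<B>" for X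
          using that c1 neighbor_in_star[of A1] unfolding orbit_extend_def by (auto simp: PiE_iff)
        then have "d (merged X) < k" if "X \<in> \<B>" for X using that d by simp
        then show ?thesis unfolding PiE_iff by (auto simp: d_def)
      qed
      have d2: "d (g ` M) = d M" if M: "M \<in> merged ` \<B>" for M
      proof -
        obtain X where X: "X \<in> \<B>" "M = merged X" using M by blast
        then have "g ` X \<in> \<B>" using \<B>_image by blast
        then have "d (g ` M) = orbit_extend c (g ` X)" using d X merge_image by metis
        also have "\<dots> = orbit_extend c X" using \<O>_image_iff[OF X(1)] c2 X(1) unfolding orbit_extend_def by auto
        finally show ?thesis using d X by simp
      qed
      have d3: "d M \<noteq> d M'" if M: "M \<in> merged ` \<B>" "M' \<in> merged ` \<B>" "branch_adj E M M'" for M M'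
      proof -
        obtain X Y where XY: "X \<in> \<B>" "Y \<in> \<B>" "M = merged X" "M' = merged Y" using M by blast
        obtain u v where uv: "u \<in> M" "v \<in> M'" "(u, v) \<in> E" "M \<noteq> M'"
          using M(3) unfolding branch_adj_def set_adj_def by blast
        obtain X' Y' where X': "(X, X') \<in> star\<^sup>*" "u \<in> X'" and Y': "(Y, Y') \<in> star\<^sup>*" "v \<in> Y'"
          using uv XY unfolding merged_def by blast
        have mem: "X' \<in> \<B>" "Y' \<in> \<B>" using X' Y' XY star_\<B> by blast+
        have MM: "merged X' = M" "merged Y' = M'" using merge_cong X' Y' XY by metis+
        then have adj: "branch_adj E X' Y'"
          using uv X' Y' unfolding branch_adj_def set_adj_def by blast
        \<comment> \<open>An edge at the orbit would have merged its two ends, so both lie outside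
          the orbit, where \<open>c\<close> is proper.\<close>
        have "(X', Y') \<notin> star" using merge_cong[of X' Y'] MM uv(4) by blast
        then have "X' \<in> \<B> - \<O>" "Y' \<in> \<B> - \<O>" using adj mem unfolding star_def by blast+
        then have "orbit_extend c X' \<noteq> orbit_extend c Y'" using c3 adj unfolding orbit_extend_def by simp
        then show ?thesis using d mem MM by metis
      qed
      have "d \<in> ?M" by (rule invariant_coloringsI[OF d1 d2 d3])
      moreover have "?f d = c"
      proof
        fix X show "?f d X = c X"
          using PiE_arb[OF c1, of X] d[of X] by (cases "X \<in> \<B> - \<O>") (auto simp: orbit_extend_def)
      qed
      ultimately show "c \<in> ?f ` ?M" by blast
    qed
  qed
  ultimately show ?thesis using card_image[of ?f ?M] by simp
qed

text \<open>A coloring with \<open>c A1 = c A2\<close> is constant along merged sets, so it would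
  agree on the adjacent sets \<open>X\<close> and \<open>Y\<close>.\<close>

lemma colorings_loop_empty:
  assumes "X \<in> \<B> - \<O>" "Y \<in> \<B> - \<O>" "branch_adj E X Y" "merged X = merged Y"
  shows "{c \<in> invariant_colorings E g (\<B> - \<O>) k. c A1 = c A2} = {}"
proof (rule ccontr)
  assume "\<not> ?thesis"
  then obtain c where c: "c \<in> invariant_colorings E g (\<B> - \<O>) k" and c4: "c A1 = c A2" by blast
  note c2 = invariant_coloringsD(2)[OF c] and c3 = invariant_coloringsD(3)[OF c]
  have "(X, Y) \<in> star\<^sup>*" using merge_eq_iff assms by blast
  then have "orbit_extend c X = orbit_extend c Y" using orbit_extend_star[of c X Y] c2 c4 by blast
  then show False using c3[OF assms(1-3)] assms(1,2) unfolding orbit_extend_def by simp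
qed

end

end

section \<open>The recursion for the counting polynomial\<close>

context graph_automorphism
begin

text \<open>If the chosen branch set has the two neighbors \<open>A1\<close> and \<open>A2\<close>, a coloring of the rest extends
  in \<open>k - 2\<close> ways, and in one more way if \<open>A1\<close> and \<open>A2\<close> have the same color. The colorings of
  the second kind are those of the contraction, unless contracting creates a loop.\<close>

lemma invariant_colorings_poly:
  assumes no_K4: "\<And>A B C D. \<not> K4_minor_sets E A B C D"
    and "invariant_family \<B>"
  shows "\<exists>p :: real poly. (\<forall>k. poly p (real k) = real (card (invariant_colorings E g \<B> k))) \<and>
    (\<forall>x\<ge>2. poly p x \<ge> 0) \<and> ((\<forall>v\<in>V. g v = v) \<longrightarrow> (\<forall>x>2. poly p x > 0))"
  using assms(2)
proof (induction "card \<B>" arbitrary: \<B> rule: less_induct)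
  case less
  note family = \<open>invariant_family \<B>\<close>
  then have fin: "finite \<B>" and branch: "branch_family E \<B>"
    unfolding invariant_family_def branch_family_def by blast+
  show ?case
  proof (cases "\<B> = {}")
    case True
    then have "invariant_colorings E g \<B> k = {\<lambda>_. undefined}" for k
      unfolding invariant_colorings_def by simp
    then show ?thesis by (intro exI[of _ 1]) simp
  next
    case False
    obtain B where B: "B \<in> \<B>" and deg: "card (neighbors \<B> B) \<le> 2"
      using branch_of_degree_le_2[OF sym_E no_K4 branch False] unfolding neighbors_def by blast
    define \<O> where "\<O> = branch_orbit \<B> B"
    show ?thesis
    proof (cases "\<exists>X\<in>\<O>. \<exists>Y\<in>\<O>. branch_adj E X Y")
      case True
      then obtain X Y where XY: "X \<in> \<O>" "Y \<in> \<O>" "branch_adj E X Y" by blast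
      then have empty: "invariant_colorings E g \<B> k = {}" for k
        using colorings_empty_of_adjacent_orbit[OF family] unfolding \<O>_def by blast
      \<comment> \<open>For the identity the orbit is \<open>{B}\<close>, and no set is adjacent to
        itself; so the zero polynomial does not conflict with strict positivity.\<close>
      have "\<not> (\<forall>v\<in>V. g v = v)"
      proof
        assume id: "\<forall>v\<in>V. g v = v"
        have fixed: "g ` Y = Y" if "Y \<in> \<B>" for Y
          using id that family unfolding invariant_family_def by force
        have "Z = B" if "Z \<in> \<O>" for Z
          using that unfolding \<O>_def by (rule branch_orbit_induct) (auto simp: fixed)
        then show False using XY unfolding branch_adj_def by blast
      qed
      then show ?thesis using empty by (intro exI[of _ 0]) auto
    next
      case False
      interpret independent_orbit V E g \<B> B
        by unfold_locales (use family B False in \<open>auto simp: \<O>_def\<close>)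
      let ?C' = "invariant_colorings E g (\<B> - \<O>)"
      have "card (\<B> - \<O>) < card \<B>"
        using fin B branch_orbit_self[OF B] unfolding \<O>_def by (intro psubset_card_mono) auto
      moreover have "invariant_family (\<B> - \<O>)"
        unfolding \<O>_def by (rule invariant_family_minus_orbit[OF family])
      ultimately obtain p' :: "real poly"
        where p': "\<And>k. poly p' (real k) = real (card (?C' k))" "\<And>x. x \<ge> 2 \<Longrightarrow> poly p' x \<ge> 0"
          "\<And>x. \<forall>v\<in>V. g v = v \<Longrightarrow> x > 2 \<Longrightarrow> poly p' x > 0"
        using less.hyps by metis
      have count: "card (invariant_colorings E g \<B> k) = (\<Sum>c\<in>?C' k. k - card (c ` neighbors \<B> B))" for k
        unfolding \<O>_def by (rule card_colorings_delete_orbit)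
      \<comment> \<open>Guards the truncated subtraction in \<open>count\<close>: as soon as a
        coloring of the rest exists, \<open>k\<close> is at least the number of colors on the
        neighbors.\<close>
      have lt: "c A < k" if "A \<in> neighbors \<B> B" "c \<in> ?C' k" for c A k
        using that neighbors_orbit[OF branch_orbit_self[OF B]] invariant_coloringsD(1)[OF that(2)]
        unfolding \<O>_def by (auto simp: PiE_iff)
      have "finite (neighbors \<B> B)" using fin unfolding neighbors_def by simp
      then consider "neighbors \<B> B = {}" | A where "neighbors \<B> B = {A}"
        | A1 A2 where "neighbors \<B> B = {A1, A2}" "A1 \<noteq> A2"
        using deg by (metis One_nat_def card_0_eq card_1_singletonE card_2_iff le_Suc_eq le_zero_eq numeral_2_eq_2)
      then show ?thesis
      proof cases
        case 1
        show ?thesis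
        proof (intro exI[of _ "[:0, 1:] * p'"] conjI allI impI)
          show "poly ([:0, 1:] * p') (real k) = real (card (invariant_colorings E g \<B> k))" for k
            unfolding count 1 by (simp add: p'(1))
        qed (use p' in auto)
      next
        case (2 A)
        show ?thesis
        proof (intro exI[of _ "[:-1, 1:] * p'"] conjI allI impI)
          show "poly ([:-1, 1:] * p') (real k) = real (card (invariant_colorings E g \<B> k))" for k
          proof -
            have "real (k - card (c ` {A})) = real k - 1" if "c \<in> ?C' k" for c
              using lt[OF _ that, of A] 2 by (simp add: of_nat_diff)
            then have "real (card (invariant_colorings E g \<B> k)) = (\<Sum>c\<in>?C' k. real k - 1)"
              unfolding count 2 of_nat_sum by (intro sum.cong) auto
            then show ?thesis by (simp add: p'(1) algebra_simps)
          qed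
          show "poly ([:-1, 1:] * p') x \<ge> 0" if "x \<ge> 2" for x
            using mult_nonneg_nonneg[of "x - 1" "poly p' x"] p'(2)[OF that] that
            by (simp add: algebra_simps)
          show "poly ([:-1, 1:] * p') x > 0" if "\<forall>v\<in>V. g v = v" "x > 2" for x
            using mult_pos_pos[of "x - 1" "poly p' x"] p'(3)[OF that] that
            by (simp add: algebra_simps)
        qed
      next
        case (3 A1 A2)
        let ?D = "\<lambda>k. {c \<in> ?C' k. c A1 = c A2}"
        \<comment> \<open>Only nonnegativity is asked of \<open>p''\<close>, since a loop makes it
          zero even for the identity. Strictness comes from
          \<open>(x - 2) * poly p' x\<close>.\<close>
        have "\<exists>p'' :: real poly. (\<forall>k. poly p'' (real k) = real (card (?D k))) \<and> (\<forall>x\<ge>2. poly p'' x \<ge> 0)"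
        proof (cases "\<exists>X\<in>\<B> - \<O>. \<exists>Y\<in>\<B> - \<O>. branch_adj E X Y \<and> merged X = merged Y")
          case True
          then obtain X Y where "X \<in> \<B> - \<O>" "Y \<in> \<B> - \<O>" "branch_adj E X Y" "merged X = merged Y"
            by blast
          then have "?D k = {}" for k
            unfolding \<O>_def by (rule colorings_loop_empty[OF 3(1)])
          then have "card (?D k) = 0" for k by (simp only: card.empty)
          then show ?thesis by (intro exI[of _ 0]) simp
        next
          case False
          then have "card (?D k) = card (invariant_colorings E g (merged ` \<B>) k)" for k
            unfolding \<O>_def by (intro card_colorings_contract[OF 3(1)]) blast
          then show ?thesis
            using less.hyps[OF card_merge_less[OF 3(1)] invariant_family_merge] by auto
        qed
        then obtain p'' :: "real poly" where p'': "\<And>k. poly p'' (real k) = real (card (?D k))"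
          "\<And>x. x \<ge> 2 \<Longrightarrow> poly p'' x \<ge> 0" by blast
        show ?thesis
        proof (intro exI[of _ "[:-2, 1:] * p' + p''"] conjI allI impI)
          show "poly ([:-2, 1:] * p' + p'') (real k) = real (card (invariant_colorings E g \<B> k))" for k
          proof -
            have summand: "real (k - card (c ` {A1, A2})) = (real k - 2) + (if c A1 = c A2 then 1 else 0)"
              if c: "c \<in> ?C' k" for c
            proof -
              have "c A1 < k" "c A2 < k" using lt[OF _ c] 3(1) by auto
              then show ?thesis by (cases "c A1 = c A2") (auto simp: of_nat_diff)
            qed
            have finC: "finite (?C' k)" using fin by (simp add: finite_invariant_colorings)
            have "real (card (invariant_colorings E g \<B> k)) =
                (\<Sum>c\<in>?C' k. (real k - 2) + (if c A1 = c A2 then 1 else 0))"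
              unfolding count 3(1) of_nat_sum using summand by (intro sum.cong) auto
            also have "\<dots> = (\<Sum>c\<in>?C' k. real k - 2) + (\<Sum>c\<in>?C' k. if c A1 = c A2 then 1 else 0)"
              by (rule sum.distrib)
            also have "(\<Sum>c\<in>?C' k. if c A1 = c A2 then 1 else 0) = real (card (?D k))"
              using finC by (simp flip: sum.inter_filter)
            finally show ?thesis by (simp add: p'(1) p''(1) algebra_simps)
          qed
          show "poly ([:-2, 1:] * p' + p'') x \<ge> 0" if "x \<ge> 2" for x
            using mult_nonneg_nonneg[of "x - 2" "poly p' x"] p'(2)[OF that] p''(2)[OF that] that
            by (simp add: algebra_simps)
          show "poly ([:-2, 1:] * p' + p'') x > 0" if "\<forall>v\<in>V. g v = v" "x > 2" for x
          proof -
            have "(x - 2) * poly p' x > 0" using p'(3)[OF that] that by simp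
            moreover have "poly p'' x \<ge> 0" using p''(2) that by simp
            ultimately show ?thesis by (simp add: algebra_simps)
          qed
        qed
      qed
    qed
  qed
qed

section \<open>Quotient colorings as invariant colorings\<close>

abbreviation singletons :: "'a set set" where "singletons \<equiv> (\<lambda>v. {v}) ` V"

lemma invariant_family_singletons: "invariant_family singletons"
proof -
  have "g ` V = V" using endo_inj_surj[OF finite_V g_V inj_g] .
  then have "(`) g ` singletons = singletons"
    by (metis (no_types, lifting) image_cong image_empty image_image image_insert)
  moreover have "branch_family E singletons"
    using finite_V unfolding branch_family_def connected_in_def by (auto intro!: disjointI)
  ultimately show ?thesis unfolding invariant_family_def by auto
qed

text \<open>\<open>\<pi>_fibre\<close> expresses through colorings that fibres of
  \<open>\<pi>\<close> are no larger than orbits of \<open>g\<close>. In this form the lemma serves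
  both the orbit map and, with \<open>\<pi> = id\<close>, the graph itself. If \<open>Q\<close> has
  a loop, both sides are 0.\<close>

lemma card_proper_colorings_quotient:
  assumes irrefl: "irrefl E"
    and Q: "pverts Q = \<pi> ` V" "parcs Q = (\<lambda>(u, v). (\<pi> u, \<pi> v)) ` E"
    and \<pi>_g: "\<And>v. v \<in> V \<Longrightarrow> \<pi> (g v) = \<pi> v"
    and \<pi>_fibre: "\<And>(d :: 'a \<Rightarrow> nat) u v. (\<And>w. w \<in> V \<Longrightarrow> d (g w) = d w) \<Longrightarrow>
      u \<in> V \<Longrightarrow> v \<in> V \<Longrightarrow> \<pi> u = \<pi> v \<Longrightarrow> d u = d v"
  shows "card (proper_colorings Q k) = card (invariant_colorings E g singletons k)"
proof -
  let ?P = "proper_colorings Q k" and ?I = "invariant_colorings E g singletons k"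
  let ?f = "\<lambda>c. restrict (\<lambda>B. c (\<pi> (the_elem B))) singletons"
  have gV: "g v \<in> V" if "v \<in> V" for v using that g_V by blast
  have adj: "branch_adj E {u} {v} \<longleftrightarrow> (u, v) \<in> E" for u v
    using irrefl unfolding branch_adj_def set_adj_def irrefl_def by auto
  have "inj_on ?f ?P"
  proof (rule inj_onI)
    fix c d assume cd: "c \<in> ?P" "d \<in> ?P" "?f c = ?f d"
    have ext: "c \<in> extensional (\<pi> ` V)" "d \<in> extensional (\<pi> ` V)"
      using cd(1,2) unfolding proper_colorings_def Q by (auto simp: PiE_iff)
    show "c = d"
    proof (rule extensionalityI[OF ext])
      fix x assume "x \<in> \<pi> ` V"
      then obtain v where "v \<in> V" "x = \<pi> v" by blast
      then show "c x = d x" using fun_cong[OF cd(3), of "{v}"] by simp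
    qed
  qed
  moreover have "?f ` ?P = ?I"
  proof
    show "?f ` ?P \<subseteq> ?I"
    proof (rule image_subsetI)
      fix c assume "c \<in> ?P"
      then have c: "c \<in> \<pi> ` V \<rightarrow>\<^sub>E {..<k}" and proper: "\<And>u v. (u, v) \<in> E \<Longrightarrow> c (\<pi> u) \<noteq> c (\<pi> v)"
        unfolding proper_colorings_def Q by auto
      show "?f c \<in> ?I"
      proof (rule invariant_coloringsI)
        show "?f c \<in> singletons \<rightarrow>\<^sub>E {..<k}" using c by (auto simp: PiE_iff)
        show "?f c (g ` A) = ?f c A" if "A \<in> singletons" for A
          using that \<pi>_g gV by auto
        show "?f c A \<noteq> ?f c B" if "A \<in> singletons" "B \<in> singletons" "branch_adj E A B" for A B
          using that adj proper by auto
      qed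
    qed
    show "?I \<subseteq> ?f ` ?P"
    proof
      fix d assume d: "d \<in> ?I"
      note d1 = invariant_coloringsD(1)[OF d] and d2 = invariant_coloringsD(2)[OF d]
        and d3 = invariant_coloringsD(3)[OF d]
      define c where "c = restrict (\<lambda>x. d {inv_into V \<pi> x}) (\<pi> ` V)"
      have c: "c (\<pi> v) = d {v}" if v: "v \<in> V" for v
      proof -
        have "inv_into V \<pi> (\<pi> v) \<in> V" "\<pi> (inv_into V \<pi> (\<pi> v)) = \<pi> v"
          using v by (auto intro: inv_into_into simp: f_inv_into_f)
        moreover have "d {g w} = d {w}" if "w \<in> V" for w using d2[of "{w}"] that by simp
        ultimately have "d {inv_into V \<pi> (\<pi> v)} = d {v}"
          using \<pi>_fibre[of "\<lambda>v. d {v}" "inv_into V \<pi> (\<pi> v)" v] v by simp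
        then show ?thesis using v unfolding c_def by simp
      qed
      have "c \<in> ?P"
      proof -
        have "d {v} < k" if "v \<in> V" for v using d1 that by (auto simp: PiE_iff)
        then have "c \<in> \<pi> ` V \<rightarrow>\<^sub>E {..<k}" using c by (auto simp: PiE_iff c_def)
        moreover have "c (\<pi> u) \<noteq> c (\<pi> v)" if "(u, v) \<in> E" for u v
          using that E_V d3[of "{u}" "{v}"] adj c by auto
        ultimately show ?thesis unfolding proper_colorings_def Q by auto
      qed
      moreover have "?f c = d"
      proof
        fix B show "?f c B = d B"
          using PiE_arb[OF d1, of B] c by (cases "B \<in> singletons") auto
      qed
      ultimately show "d \<in> ?f ` ?P" by blast
    qed
  qed
  ultimately show ?thesis using card_image[of ?f ?P] by simp
qed

lemma chromatic_poly_quotient: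
  assumes no_K4: "\<And>A B C D. \<not> K4_minor_sets E A B C D"
    and irrefl: "irrefl E"
    and Q: "pverts Q = \<pi> ` V" "parcs Q = (\<lambda>(u, v). (\<pi> u, \<pi> v)) ` E"
    and \<pi>_g: "\<And>v. v \<in> V \<Longrightarrow> \<pi> (g v) = \<pi> v"
    and \<pi>_fibre: "\<And>(d :: 'a \<Rightarrow> nat) u v. (\<And>w. w \<in> V \<Longrightarrow> d (g w) = d w) \<Longrightarrow>
      u \<in> V \<Longrightarrow> v \<in> V \<Longrightarrow> \<pi> u = \<pi> v \<Longrightarrow> d u = d v"
  shows "x \<ge> 2 \<Longrightarrow> poly (chromatic_poly Q) x \<ge> 0"
    and "(\<And>v. v \<in> V \<Longrightarrow> g v = v) \<Longrightarrow> x > 2 \<Longrightarrow> poly (chromatic_poly Q) x > 0"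
proof -
  have fin: "pair_fin_digraph Q"
    using finite_V E_V finite_subset[OF E_V] Q by unfold_locales auto
  obtain p :: "real poly" where p: "\<forall>k. poly p (real k) = real (card (invariant_colorings E g singletons k))"
    "\<forall>x\<ge>2. poly p x \<ge> 0" "(\<forall>v\<in>V. g v = v) \<longrightarrow> (\<forall>x>2. poly p x > 0)"
    using invariant_colorings_poly[OF no_K4 invariant_family_singletons] by blast
  have "card (proper_colorings Q k) = card (invariant_colorings E g singletons k)" for k
    using card_proper_colorings_quotient[OF irrefl Q \<pi>_g \<pi>_fibre] by blast
  then have "\<forall>k>0. poly p (real k) = real (card (proper_colorings Q k))" using p(1) by simp
  then have "chromatic_poly Q = p"
    unfolding chromatic_poly_def by (rule the1_equality[OF ex1_chromatic_poly[OF fin]])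
  then show "x \<ge> 2 \<Longrightarrow> poly (chromatic_poly Q) x \<ge> 0"
    and "(\<And>v. v \<in> V \<Longrightarrow> g v = v) \<Longrightarrow> x > 2 \<Longrightarrow> poly (chromatic_poly Q) x > 0"
    using p(2,3) by auto
qed

end

section \<open>Quotients by automorphisms\<close>

lemma graph_aut_group_mult:
  assumes "f \<in> carrier (graph_aut_group \<Gamma>)" "h \<in> carrier (graph_aut_group \<Gamma>)" "v \<in> pverts \<Gamma>"
  shows "(f \<otimes>\<^bsub>graph_aut_group \<Gamma>\<^esub> h) v = f (h v)"
  using assms unfolding graph_aut_group_def by (simp add: BijGroup_def compose_eq)

lemma graph_aut_group_one: "v \<in> pverts \<Gamma> \<Longrightarrow> \<one>\<^bsub>graph_aut_group \<Gamma>\<^esub> v = v"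
  unfolding graph_aut_group_def by (simp add: BijGroup_def)

lemma graph_aut_group_mem:
  "f \<in> carrier (graph_aut_group \<Gamma>) \<Longrightarrow> v \<in> pverts \<Gamma> \<Longrightarrow> f v \<in> pverts \<Gamma>"
  unfolding graph_aut_group_def by (auto simp: Bij_def bij_betw_def)

lemma graph_automorphism_of_aut:
  assumes "pair_graph \<Gamma>" "g \<in> carrier (graph_aut_group \<Gamma>)"
  shows "graph_automorphism (pverts \<Gamma>) (parcs \<Gamma>) g"
proof -
  interpret pair_graph \<Gamma> by (rule assms(1))
  have g: "bij_betw g (pverts \<Gamma>) (pverts \<Gamma>)"
    "\<And>u v. u \<in> pverts \<Gamma> \<Longrightarrow> v \<in> pverts \<Gamma> \<Longrightarrow> (g u, g v) \<in> parcs \<Gamma> \<longleftrightarrow> (u, v) \<in> parcs \<Gamma>"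
    using assms(2) unfolding graph_aut_group_def by (auto simp: Bij_def)
  show ?thesis
  proof
    show "parcs \<Gamma> \<subseteq> pverts \<Gamma> \<times> pverts \<Gamma>" using in_arcsD1 in_arcsD2 by auto
    show "sym (parcs \<Gamma>)" using pair_sym_arcs by (simp add: symmetric_def)
  qed (use g pair_finite_verts in \<open>auto simp: bij_betw_def\<close>)
qed

lemma chromatic_poly_quotient_graph:
  assumes \<Gamma>: "pair_graph \<Gamma>" and no_K4: "\<And>A B C D. \<not> K4_minor_sets (parcs \<Gamma>) A B C D"
    and g: "g \<in> carrier (graph_aut_group \<Gamma>)"
  shows "x \<ge> 2 \<Longrightarrow> poly (chromatic_poly (quotient_graph \<Gamma> g)) x \<ge> 0"
    and "(\<And>v. v \<in> pverts \<Gamma> \<Longrightarrow> g v = v) \<Longrightarrow> x > 2 \<Longrightarrow>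
      poly (chromatic_poly (quotient_graph \<Gamma> g)) x > 0"
proof -
  interpret pair_graph \<Gamma> by (rule \<Gamma>)
  interpret graph_automorphism "pverts \<Gamma>" "parcs \<Gamma>" g by (rule graph_automorphism_of_aut[OF \<Gamma> g])
  let ?A = "graph_aut_group \<Gamma>" and ?V = "pverts \<Gamma>"
  interpret A: Group.group ?A by (rule group_graph_aut_group)
  define H where "H = carrier (subgroup_generated ?A {g})"
  have H: "H = generate ?A {g}" using g unfolding H_def carrier_subgroup_generated by simp
  have H_A: "H \<subseteq> carrier ?A" using A.generate_incl[of "{g}"] g unfolding H by blast
  have subH: "subgroup H ?A" using A.generate_is_subgroup[of "{g}"] g unfolding H by blast
  define \<pi> where "\<pi> v = (\<lambda>h. h v) ` H" for v
  have orbits: "cyclic_orbits \<Gamma> g = \<pi> ` ?V"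
    unfolding cyclic_orbits_def orbits_def orbit_def \<pi>_def H_def by blast
  have \<pi>_self: "v \<in> \<pi> v" if "v \<in> ?V" for v
    using subgroup.one_closed[OF subH] graph_aut_group_one[OF that] unfolding \<pi>_def by (metis image_eqI)
  have \<pi>_sub: "\<pi> v \<subseteq> ?V" if "v \<in> ?V" for v
    using graph_aut_group_mem[OF subsetD[OF H_A] that] unfolding \<pi>_def by (intro image_subsetI)
  have \<pi>_le: "\<pi> (h v) \<subseteq> \<pi> v" if "h \<in> H" "v \<in> ?V" for h v
  proof
    fix w assume "w \<in> \<pi> (h v)"
    then obtain f where f: "f \<in> H" "w = f (h v)" unfolding \<pi>_def by blast
    then have "w = (f \<otimes>\<^bsub>?A\<^esub> h) v"
      using graph_aut_group_mult[OF subsetD[OF H_A f(1)] subsetD[OF H_A that(1)] that(2)] by simp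
    then show "w \<in> \<pi> v" using subgroup.m_closed[OF subH f(1) that(1)] unfolding \<pi>_def by blast
  qed
  have \<pi>_eq: "\<pi> u = \<pi> v" if v: "v \<in> ?V" and u: "u \<in> \<pi> v" for u v
  proof
    obtain h where h: "h \<in> H" "u = h v" using u unfolding \<pi>_def by blast
    show "\<pi> u \<subseteq> \<pi> v" using \<pi>_le h v by blast
    have ih: "inv\<^bsub>?A\<^esub> h \<in> H" by (rule subgroup.m_inv_closed[OF subH h(1)])
    have "(inv\<^bsub>?A\<^esub> h) u = (inv\<^bsub>?A\<^esub> h \<otimes>\<^bsub>?A\<^esub> h) v"
      using graph_aut_group_mult[of "inv\<^bsub>?A\<^esub> h" \<Gamma> h v] ih h H_A v by auto
    also have "\<dots> = v" using h H_A A.l_inv[of h] graph_aut_group_one[OF v] by auto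
    finally show "\<pi> v \<subseteq> \<pi> u" using \<pi>_le[OF ih, of u] \<pi>_sub[OF v] u by auto
  qed
  have gH: "g \<in> H" unfolding H by (rule generate.incl) simp
  have \<pi>_g: "\<pi> (g v) = \<pi> v" if "v \<in> ?V" for v
    using \<pi>_eq[OF that, of "g v"] gH unfolding \<pi>_def by blast
  \<comment> \<open>Orbits are defined by the generated subgroup, but colorings are only known to be
    invariant under its generator; induction over \<open>generate\<close> closes this gap.\<close>
  have d_H: "\<forall>v\<in>?V. d (h v) = d v"
    if d: "\<And>w. w \<in> ?V \<Longrightarrow> d (g w) = d w" and h: "h \<in> H" for d :: "'a \<Rightarrow> nat" and h
    using h unfolding H
  proof (induction rule: generate.induct)
    case one
    then show ?case by (simp add: graph_aut_group_one)
  next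
    case (incl h)
    then show ?case using d by simp
  next
    case (inv h)
    then have h: "h = g" by simp
    show ?case unfolding h
    proof
      fix v assume v: "v \<in> ?V"
      have ig: "inv\<^bsub>?A\<^esub> g \<in> carrier ?A" using g by simp
      have "g ((inv\<^bsub>?A\<^esub> g) v) = v"
        using graph_aut_group_mult[OF g ig v] A.r_inv[OF g] graph_aut_group_one[OF v] by simp
      then show "d ((inv\<^bsub>?A\<^esub> g) v) = d v" using d graph_aut_group_mem[OF ig v] by metis
    qed
  next
    case (eng h1 h2)
    have "h1 \<in> carrier ?A" "h2 \<in> carrier ?A" using eng H_A unfolding H by auto
    then show ?case using eng graph_aut_group_mult graph_aut_group_mem by metis
  qed
  have \<pi>_fibre: "d u = d v" if d: "\<And>w. w \<in> ?V \<Longrightarrow> d (g w) = d w" and uv: "u \<in> ?V" "v \<in> ?V" "\<pi> u = \<pi> v"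
    for d :: "'a \<Rightarrow> nat" and u v
  proof -
    have "u \<in> \<pi> v" using \<pi>_self uv by blast
    then obtain h where "h \<in> H" "u = h v" unfolding \<pi>_def by blast
    then show ?thesis using d_H[of d h] d uv by blast
  qed
  have verts: "pverts (quotient_graph \<Gamma> g) = \<pi> ` ?V" unfolding quotient_graph_def orbits by simp
  have arcs: "parcs (quotient_graph \<Gamma> g) = (\<lambda>(u, v). (\<pi> u, \<pi> v)) ` parcs \<Gamma>"
  proof
    show "parcs (quotient_graph \<Gamma> g) \<subseteq> (\<lambda>(u, v). (\<pi> u, \<pi> v)) ` parcs \<Gamma>"
    proof (rule subrelI)
      fix X Y assume "(X, Y) \<in> parcs (quotient_graph \<Gamma> g)"
      then obtain a b u v where a: "a \<in> ?V" "X = \<pi> a" "u \<in> X" and b: "b \<in> ?V" "Y = \<pi> b" "v \<in> Y"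
        and uv: "(u, v) \<in> parcs \<Gamma>"
        unfolding quotient_graph_def orbits by auto
      have "X = \<pi> u" "Y = \<pi> v" using \<pi>_eq[OF a(1), of u] \<pi>_eq[OF b(1), of v] a b by simp_all
      with uv show "(X, Y) \<in> (\<lambda>(u, v). (\<pi> u, \<pi> v)) ` parcs \<Gamma>" by force
    qed
    show "(\<lambda>(u, v). (\<pi> u, \<pi> v)) ` parcs \<Gamma> \<subseteq> parcs (quotient_graph \<Gamma> g)"
    proof (rule image_subsetI)
      fix e assume e: "e \<in> parcs \<Gamma>"
      obtain u v where uv: "e = (u, v)" by (cases e)
      then have "u \<in> ?V" "v \<in> ?V" using in_arcsD1 in_arcsD2 e by blast+
      then have "\<pi> u \<in> \<pi> ` ?V" "\<pi> v \<in> \<pi> ` ?V" "u \<in> \<pi> u" "v \<in> \<pi> v" using \<pi>_self by blast+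
      then show "(case e of (u, v) \<Rightarrow> (\<pi> u, \<pi> v)) \<in> parcs (quotient_graph \<Gamma> g)"
        using e unfolding quotient_graph_def orbits uv by auto
    qed
  qed
  have irrefl: "irrefl (parcs \<Gamma>)" using no_loops' by (auto simp: irrefl_def)
  show "poly (chromatic_poly (quotient_graph \<Gamma> g)) x \<ge> 0" if "x \<ge> 2"
    by (rule chromatic_poly_quotient(1)[OF no_K4 irrefl verts arcs \<pi>_g]) (auto intro: \<pi>_fibre that)
  show "poly (chromatic_poly (quotient_graph \<Gamma> g)) x > 0" if "\<And>v. v \<in> ?V \<Longrightarrow> g v = v" "x > 2"
    by (rule chromatic_poly_quotient(2)[OF no_K4 irrefl verts arcs \<pi>_g]) (auto intro: \<pi>_fibre that)
qed

text \<open>Each arc switches between the two colors. The ends are kept different so that the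
  induction can shorten the walk; \<open>u = v\<close> then rules out odd closed walks.\<close>

lemma two_coloring_parity:
  assumes "pair_wf_digraph \<Gamma>" "c \<in> proper_colorings \<Gamma> 2" "v \<in> pverts \<Gamma>"
    and "set es \<subseteq> parcs \<Gamma>" "pre_digraph.cas (with_proj \<Gamma>) u es v"
  shows "c u = c v \<longleftrightarrow> even (length es)"
  using assms(4,5)
proof (induction es arbitrary: u)
  case Nil
  then show ?case by (simp add: pre_digraph.cas.simps)
next
  case (Cons e es)
  interpret pair_wf_digraph \<Gamma> by (rule assms(1))
  obtain w where e: "e = (u, w)" and es: "pre_digraph.cas (with_proj \<Gamma>) w es v"
    using Cons.prems(2) by (cases e) (auto simp: pre_digraph.cas.simps)
  have arc: "(u, w) \<in> parcs \<Gamma>" using Cons.prems(1) e by simp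
  then have "c u \<noteq> c w" "c u < 2" "c w < 2" "c v < 2"
    using assms(2,3) in_arcsD1[OF arc] in_arcsD2[OF arc] unfolding proper_colorings_def by auto
  moreover have "c w = c v \<longleftrightarrow> even (length es)" using Cons es by simp
  ultimately show ?case by auto
qed

theorem theorem1p3:
  fixes \<Gamma> :: "'a pair_pre_digraph" and G :: "('a \<Rightarrow> 'a) set"
  assumes "pair_graph \<Gamma>"
    and "outerplanar \<Gamma>"
    and "has_odd_cycle \<Gamma>"
    and "subgroup G (graph_aut_group \<Gamma>)"
  shows "\<exists>r. is_largest_real_root (chromatic_poly \<Gamma>) r \<and>
    (\<forall>x. poly (orbital_chromatic_poly \<Gamma> G) x = 0 \<longrightarrow> x \<le> r)"
proof (intro exI[of _ 2] conjI allI impI)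
  interpret pair_graph \<Gamma> by (rule assms(1))
  let ?V = "pverts \<Gamma>" and ?A = "graph_aut_group \<Gamma>"
  obtain p \<gamma> where drawing: "plane_drawing \<Gamma> p \<gamma>"
    and outer: "p ` ?V \<subseteq> frontier (outside (drawing_image \<Gamma> p \<gamma>))"
    using assms(2) unfolding outerplanar_def by blast
  have no_K4: "\<not> K4_minor_sets (parcs \<Gamma>) A B C D" for A B C D
    by (rule no_outer_K4_minor[OF assms(1) drawing outer])
  have irrefl: "irrefl (parcs \<Gamma>)" using no_loops' by (auto simp: irrefl_def)
  \<comment> \<open>Taking \<open>id\<close> both as automorphism and as quotient map covers the
    chromatic polynomial of \<open>\<Gamma>\<close> itself, without passing to the isomorphic graph
    of singleton orbits.\<close>
  interpret id: graph_automorphism ?V "parcs \<Gamma>" id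
    using pair_finite_verts in_arcsD1 in_arcsD2 pair_sym_arcs by unfold_locales (auto simp: symmetric_def)
  have pos: "poly (chromatic_poly \<Gamma>) x > 0" if "x > 2" for x
    by (rule id.chromatic_poly_quotient(2)[OF no_K4 irrefl, where \<pi> = id]) (use that in auto)
  have "proper_colorings \<Gamma> 2 = {}"
  proof (rule ccontr)
    assume "proper_colorings \<Gamma> 2 \<noteq> {}"
    then obtain c where c: "c \<in> proper_colorings \<Gamma> 2" by blast
    obtain es where es: "pre_digraph.cycle (with_proj \<Gamma>) es" "odd (length es)"
      using assms(3) unfolding has_odd_cycle_def by blast
    then obtain u where "u \<in> ?V" "set es \<subseteq> parcs \<Gamma>" "pre_digraph.cas (with_proj \<Gamma>) u es u"
      unfolding pre_digraph.cycle_def pre_digraph.awalk_def by auto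
    from two_coloring_parity[OF pair_wf_digraph c this] show False using es(2) by simp
  qed
  then have "poly (chromatic_poly \<Gamma>) 2 = 0"
    using poly_chromatic_poly[OF pair_fin_digraph, of 2] by simp
  then show "is_largest_real_root (chromatic_poly \<Gamma>) 2"
    using pos unfolding is_largest_real_root_def by (metis less_irrefl not_le)
  fix x assume root: "poly (orbital_chromatic_poly \<Gamma> G) x = 0"
  show "x \<le> 2"
  proof (rule ccontr)
    assume "\<not> x \<le> 2"
    then have x: "x > 2" by simp
    have G: "G \<subseteq> carrier ?A" "\<one>\<^bsub>?A\<^esub> \<in> G"
      using subgroup.subset[OF assms(4)] subgroup.one_closed[OF assms(4)] by auto
    \<comment> \<open>Members of \<open>G\<close> are extensional, so there are finitely many. For
      an infinite set \<open>card G\<close> would be 0 and the orbital polynomial would vanish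
      identically.\<close>
    have "G \<subseteq> ?V \<rightarrow>\<^sub>E ?V"
    proof
      fix f assume "f \<in> G"
      then have "f \<in> Bij ?V" using G(1) unfolding graph_aut_group_def by auto
      then show "f \<in> ?V \<rightarrow>\<^sub>E ?V" by (simp add: PiE_def Bij_imp_extensional Bij_imp_funcset)
    qed
    then have fin: "finite G" using finite_PiE[OF pair_finite_verts] pair_finite_verts
      by (metis finite_subset)
    have "poly (chromatic_poly (quotient_graph \<Gamma> g)) x \<ge> 0" if "g \<in> G" for g
      using chromatic_poly_quotient_graph(1)[OF assms(1) no_K4] that G(1) x by auto
    \<comment> \<open>The one strictly positive term of the sum.\<close>
    moreover have "poly (chromatic_poly (quotient_graph \<Gamma> \<one>\<^bsub>?A\<^esub>)) x > 0"
      using G x by (intro chromatic_poly_quotient_graph(2)[OF assms(1) no_K4]) (auto simp: graph_aut_group_one)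
    ultimately have "(\<Sum>g\<in>G. poly (chromatic_poly (quotient_graph \<Gamma> g)) x) > 0"
      using fin G(2) by (intro sum_pos2) auto
    moreover have "card G > 0" using fin G(2) by (auto simp: card_gt_0_iff)
    ultimately have "poly (orbital_chromatic_poly \<Gamma> G) x > 0"
      unfolding orbital_chromatic_poly_def by (simp add: poly_sum)
    then show False using root by simp
  qed
qed

end
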